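(* Let $(L,C)$ be a pair consisting of an oriented virtual link diagram $L$ and a Cheng coloring $C$ of $L$, and define $$P_{(L,C)}(t)=\sum_{c}\mathrm{sgn}(c)\,\bigl(t^{W(c)}-1\bigr),$$ where the sum is over all classical crossings $c$ of $L$ and the weights $W(c)$ are computed from the coloring $C$. Then $P_{(L,C)}(t)$ is an invariant of the pair $(L,C)$: if $L'$ is obtained from $L$ by an oriented virtual isotopy move and $C'$ is the Cheng coloring of $L'$ obtained from $C$ by the move, then $P_{(L',C')}(t)=P_{(L,C)}(t)$.
   Context: A virtual link diagram is a generically immersed collection of closed curves in the plane in which every double point is either a classical crossing (with over/under information) or a virtual crossing (no over/under information). The virtual isotopy moves, on diagrams taken up to planar isotopy, are the classical Reidemeister moves I, II, III (involving only classical crossings) and the detour move: an arc containing a consecutive sequence of virtual crossings and no classical crossings may be excised and replaced by any other arc with the same endpoints, all of whose crossings with the rest of the diagram and with itself are virtual. All oriented versions of these moves are allowed. An arc of an oriented diagram is an edge going, in the direction of orientation, from one classical crossing to the next, possibly passing through virtual crossings. (If a component has no classical crossings, the whole component is a single arc.) A Cheng coloring of an oriented virtual diagram is an assignment of an integer to each arc such that the following holds at each classical crossing. Draw the crossing with both strands directed upward, with left incoming arc labeled $a$ and right incoming arc labeled $b$. Then the right outgoing arc (the continuation of the left incoming strand) is labeled $a-1$, and the left outgoing arc (the continuation of the right incoming strand) is labeled $b+1$. This does not depend on which strand is over. Labels do not change at virtual crossings. A link diagram need not admit a Cheng coloring. If $(L,C)$ is a colored diagram and $L'$ is obtained from $L$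 by a move, then the coloring $C'$ obtained from $C$ by the move is the unique Cheng coloring of $L'$ that agrees with $C$ outside the local site of the move. The sign $\mathrm{sgn}(c)\in\{+1,-1\}$ of a classical crossing is the usual one. With both strands directed upward, $\mathrm{sgn}(c)=+1$ if the overcrossing strand goes from lower left to upper right, and $\mathrm{sgn}(c)=-1$ if it goes from lower right to upper left. At a classical crossing $c$ with left incoming label $a$ and right incoming label $b$, put $W_+(c)=a-(b+1)$ and $W_-(c)=b-(a-1)=-W_+(c)$. The weight is $W(c)=W_+(c)$ if $\mathrm{sgn}(c)=+1$ and $W(c)=W_-(c)$ if $\mathrm{sgn}(c)=-1$. *)

theory Defs
  imports "HOL-Analysis.Analysis" "HOL-Computational_Algebra.Formal_Laurent_Series"
begin

section \<open>Oriented virtual link diagrams\<close>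

text \<open>
  The plane is \<^typ>\<open>complex\<close>.  Component \<open>i\<close> is a closed curve, parametrised as a 1-periodic
  immersion of the real line; increasing parameter gives the orientation.  A preimage point of the
  diagram is a pair \<open>(i, s)\<close> with \<open>s\<close> in the fundamental domain \<open>[0, 1)\<close>, and a double point is a
  pair of distinct preimage points with the same image.  The pair \<open>(p, q)\<close> lies in \<open>overs\<close> iff
  this double point is a classical crossing at which the strand through \<open>p\<close> is the overcrossing
  one.  A double point listed in neither order is a virtual crossing.
\<close>

type_synonym preimage = "nat \<times> real"

record diagram =
  ncomp :: nat
  curve :: "nat \<Rightarrow> real \<Rightarrow> complex"
  overs :: "(preimage \<times> preimage) set"

definition preimages :: "diagram \<Rightarrow> preimage set" where
  "preimages L = {..<ncomp L} \<times> {0..<1}"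

definition image_point :: "diagram \<Rightarrow> preimage \<Rightarrow> complex" where
  "image_point L p = curve L (fst p) (snd p)"

definition tangent :: "diagram \<Rightarrow> preimage \<Rightarrow> complex" where
  "tangent L p = vector_derivative (curve L (fst p)) (at (snd p))"

definition double_points :: "diagram \<Rightarrow> (preimage \<times> preimage) set" where
  "double_points L = {(p, q). p \<in> preimages L \<and> q \<in> preimages L \<and> p \<noteq> q \<and>
                              image_point L p = image_point L q}"

text \<open>Positive iff the direction \<open>v\<close> lies counterclockwise (by less than a half turn) from \<open>u\<close>.\<close>

definition cross2 :: "complex \<Rightarrow> complex \<Rightarrow> real" where
  "cross2 u v = Re u * Im v - Im u * Re v"

definition closed_immersion :: "(real \<Rightarrow> complex) \<Rightarrow> bool" where
  "closed_immersion \<gamma> \<longleftrightarrow> \<gamma> C1_differentiable_on UNIV \<and> (\<forall>s. \<gamma> (s + 1) = \<gamma> s) \<and>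
                          (\<forall>s. vector_derivative \<gamma> (at s) \<noteq> 0)"

definition virtual_link_diagram :: "diagram \<Rightarrow> bool" where
  "virtual_link_diagram L \<longleftrightarrow>
     (\<forall>i<ncomp L. closed_immersion (curve L i)) \<and>
     finite (double_points L) \<and>
     (\<forall>(p, q)\<in>double_points L. cross2 (tangent L p) (tangent L q) \<noteq> 0) \<and>
     (\<forall>p q r. (p, q) \<in> double_points L \<and> (p, r) \<in> double_points L \<longrightarrow> q = r) \<and>
     overs L \<subseteq> double_points L \<and>
     (\<forall>p q. (p, q) \<in> overs L \<longrightarrow> (q, p) \<notin> overs L)"


section \<open>Cheng colorings, signs, weights\<close>

text \<open>
  With both strands drawn upward, the left incoming strand is the one running from lower left to
  upper right, i.e. the one from which the other direction is reached counterclockwise.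
\<close>

definition crossing_sign :: "diagram \<Rightarrow> preimage \<times> preimage \<Rightarrow> int" where
  "crossing_sign L c = (if cross2 (tangent L (fst c)) (tangent L (snd c)) > 0 then 1 else - 1)"

definition left_incoming :: "diagram \<Rightarrow> preimage \<times> preimage \<Rightarrow> preimage" where
  "left_incoming L c =
     (if cross2 (tangent L (fst c)) (tangent L (snd c)) > 0 then fst c else snd c)"

definition right_incoming :: "diagram \<Rightarrow> preimage \<times> preimage \<Rightarrow> preimage" where
  "right_incoming L c =
     (if cross2 (tangent L (fst c)) (tangent L (snd c)) > 0 then snd c else fst c)"

definition classical_at :: "diagram \<Rightarrow> nat \<Rightarrow> real \<Rightarrow> bool" where
  "classical_at L i s \<longleftrightarrow> (\<exists>q. ((i, frac s), q) \<in> overs L \<or> (q, (i, frac s)) \<in> overs L)"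

text \<open>
  A labelling of arcs is represented by the function sending a parameter to the label of the arc
  on which it lies.  Convention: a passage through a classical crossing is counted with the arc
  that ends there, so arcs are half-open intervals \<open>(s, t]\<close> between consecutive classical passages.
  Thus the value at a classical passage is the incoming label, and the outgoing label is the value
  immediately afterwards.
\<close>

type_synonym labelling = "nat \<Rightarrow> real \<Rightarrow> int"

definition arc_labelling :: "diagram \<Rightarrow> labelling \<Rightarrow> bool" where
  "arc_labelling L C \<longleftrightarrow> (\<forall>i<ncomp L.
     (\<forall>s. C i (s + 1) = C i s) \<and>
     (\<forall>s t. s < t \<and> (\<forall>u\<in>{s..<t}. \<not> classical_at L i u) \<longrightarrow> C i s = C i t))"

definition incoming_label :: "labelling \<Rightarrow> preimage \<Rightarrow> int" where
  "incoming_label C p = C (fst p) (snd p)"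

definition has_outgoing_label :: "labelling \<Rightarrow> preimage \<Rightarrow> int \<Rightarrow> bool" where
  "has_outgoing_label C p a \<longleftrightarrow> (\<forall>\<^sub>F u in at_right (snd p). C (fst p) u = a)"

definition cheng_coloring :: "diagram \<Rightarrow> labelling \<Rightarrow> bool" where
  "cheng_coloring L C \<longleftrightarrow> arc_labelling L C \<and>
     (\<forall>c\<in>overs L.
        has_outgoing_label C (left_incoming L c) (incoming_label C (left_incoming L c) - 1) \<and>
        has_outgoing_label C (right_incoming L c) (incoming_label C (right_incoming L c) + 1))"

definition weight_plus :: "diagram \<Rightarrow> labelling \<Rightarrow> preimage \<times> preimage \<Rightarrow> int" where
  "weight_plus L C c =
     incoming_label C (left_incoming L c) - (incoming_label C (right_incoming L c) + 1)"

definition weight_minus :: "diagram \<Rightarrow> labelling \<Rightarrow> preimage \<times> preimage \<Rightarrow> int" where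
  "weight_minus L C c =
     incoming_label C (right_incoming L c) - (incoming_label C (left_incoming L c) - 1)"

definition weight :: "diagram \<Rightarrow> labelling \<Rightarrow> preimage \<times> preimage \<Rightarrow> int" where
  "weight L C c = (if crossing_sign L c = 1 then weight_plus L C c else weight_minus L C c)"

text \<open>The Laurent polynomial lives in the formal Laurent series; \<open>fls_X_intpow k\<close> is \<open>t\<^sup>k\<close>.\<close>

definition cheng_poly :: "diagram \<Rightarrow> labelling \<Rightarrow> int fls" where
  "cheng_poly L C = (\<Sum>c\<in>overs L. of_int (crossing_sign L c) * (fls_X_intpow (weight L C c) - 1))"


section \<open>Planar isotopy and reparametrisation\<close>

definition ambient_isotopy :: "(real \<Rightarrow> complex \<Rightarrow> complex) \<Rightarrow> bool" where
  "ambient_isotopy H \<longleftrightarrow>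
     (\<forall>z. H 0 z = z) \<and>
     continuous_on ({0..1} \<times> UNIV) (\<lambda>(t, z). H t z) \<and>
     (\<forall>t\<in>{0..1}. bij (H t)) \<and>
     (\<exists>D :: real \<Rightarrow> complex \<Rightarrow> complex \<Rightarrow>\<^sub>L complex.
        continuous_on ({0..1} \<times> UNIV) (\<lambda>(t, z). D t z) \<and>
        (\<forall>t\<in>{0..1}. \<forall>z. (H t has_derivative blinfun_apply (D t z)) (at z) \<and>
                         bij (blinfun_apply (D t z))))"

definition planar_isotopic :: "diagram \<Rightarrow> diagram \<Rightarrow> bool" where
  "planar_isotopic L L' \<longleftrightarrow> ncomp L' = ncomp L \<and> overs L' = overs L \<and>
     (\<exists>H. ambient_isotopy H \<and> (\<forall>i<ncomp L. \<forall>s. curve L' i s = H 1 (curve L i s)))"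

text \<open>
  A diagram is a collection of oriented closed curves, so the numbering \<open>\<pi>\<close> of the components and
  the oriented parametrisations \<open>\<rho>\<close> (including the base points) are immaterial.
\<close>

definition reparametrised ::
  "(nat \<Rightarrow> nat) \<Rightarrow> (nat \<Rightarrow> real \<Rightarrow> real) \<Rightarrow> diagram \<Rightarrow> diagram \<Rightarrow> bool" where
  "reparametrised \<pi> \<rho> L L' \<longleftrightarrow>
     ncomp L' = ncomp L \<and> bij_betw \<pi> {..<ncomp L} {..<ncomp L} \<and>
     (\<forall>i<ncomp L. \<rho> i C1_differentiable_on UNIV \<and>
        (\<forall>s. vector_derivative (\<rho> i) (at s) > 0 \<and> \<rho> i (s + 1) = \<rho> i s + 1 \<and>
             curve L' i s = curve L (\<pi> i) (\<rho> i s))) \<and>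
     overs L' = {((i, s), (j, t)) | i s j t.
                   (i, s) \<in> preimages L' \<and> (j, t) \<in> preimages L' \<and>
                   ((\<pi> i, frac (\<rho> i s)), (\<pi> j, frac (\<rho> j t))) \<in> overs L}"


section \<open>Local moves\<close>

text \<open>
  A strand \<open>(i, a, b)\<close> is the part of component \<open>i\<close> between the parameters \<open>a\<close> and \<open>b\<close>.  The
  orientation runs from \<open>a\<close> to \<open>b\<close> if \<open>a < b\<close>, and from \<open>b\<close> to \<open>a\<close> if \<open>b < a\<close>.  Strands avoid the
  base point of the component, which is no restriction up to reparametrisation.
\<close>

type_synonym strand = "nat \<times> real \<times> real"

definition open_strand :: "strand \<Rightarrow> preimage set" where
  "open_strand = (\<lambda>(i, a, b). {i} \<times> open_segment a b)"

definition closed_strand :: "strand \<Rightarrow> preimage set" where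
  "closed_strand = (\<lambda>(i, a, b). {i} \<times> closed_segment a b)"

definition proper_strand :: "diagram \<Rightarrow> strand \<Rightarrow> bool" where
  "proper_strand L = (\<lambda>(i, a, b). i < ncomp L \<and> a \<in> {0<..<1} \<and> b \<in> {0<..<1} \<and> a \<noteq> b)"

definition curves_agree_off :: "strand set \<Rightarrow> diagram \<Rightarrow> diagram \<Rightarrow> bool" where
  "curves_agree_off S L L' \<longleftrightarrow> ncomp L' = ncomp L \<and>
     (\<forall>p\<in>preimages L - (\<Union>\<sigma>\<in>S. open_strand \<sigma>). image_point L' p = image_point L p)"

definition labels_agree_off :: "strand set \<Rightarrow> diagram \<Rightarrow> labelling \<Rightarrow> labelling \<Rightarrow> bool" where
  "labels_agree_off S L C C' \<longleftrightarrow>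
     (\<forall>(i, s)\<in>preimages L - (\<Union>\<sigma>\<in>S. open_strand \<sigma>). C' i s = C i s)"

text \<open>
  The disk in which a Reidemeister move takes place is the square \<open>[-1, 1]\<^sup>2\<close> (any other position of
  the disk is obtained by planar isotopy).  The strands in \<open>S\<close> are the parts of both diagrams in the
  square; \<open>X\<close> and \<open>X'\<close> are the classical crossings in the square before and after the move.
\<close>

definition meets_square_in :: "diagram \<Rightarrow> strand set \<Rightarrow> bool" where
  "meets_square_in L S \<longleftrightarrow> (\<forall>p\<in>preimages L.
     (image_point L p \<in> cbox (- 1 - \<i>) (1 + \<i>) \<longleftrightarrow> p \<in> (\<Union>\<sigma>\<in>S. closed_strand \<sigma>)) \<and>
     (image_point L p \<in> box (- 1 - \<i>) (1 + \<i>) \<longleftrightarrow> p \<in> (\<Union>\<sigma>\<in>S. open_strand \<sigma>)))"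

definition replaces_in_square ::
  "strand set \<Rightarrow> (preimage \<times> preimage) set \<Rightarrow> (preimage \<times> preimage) set \<Rightarrow> diagram \<Rightarrow> diagram \<Rightarrow> bool" where
  "replaces_in_square S X X' L L' \<longleftrightarrow>
     (\<forall>\<sigma>\<in>S. proper_strand L \<sigma>) \<and>
     (\<forall>\<sigma>\<in>S. \<forall>\<tau>\<in>S. \<sigma> \<noteq> \<tau> \<longrightarrow> closed_strand \<sigma> \<inter> closed_strand \<tau> = {}) \<and>
     curves_agree_off S L L' \<and> meets_square_in L S \<and> meets_square_in L' S \<and>
     (\<exists>R. (\<forall>(p, q)\<in>R. p \<notin> (\<Union>\<sigma>\<in>S. closed_strand \<sigma>) \<and> q \<notin> (\<Union>\<sigma>\<in>S. closed_strand \<sigma>)) \<and>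
          overs L = R \<union> X \<and> overs L' = R \<union> X')"

definition ordered_crossing :: "bool \<Rightarrow> preimage \<Rightarrow> preimage \<Rightarrow> preimage \<times> preimage" where
  "ordered_crossing first_over p q = (if first_over then (p, q) else (q, p))"

text \<open>An embedded arc is replaced by an arc with exactly one, classical, self-crossing.\<close>

definition reidemeister1 :: "strand set \<Rightarrow> diagram \<Rightarrow> diagram \<Rightarrow> bool" where
  "reidemeister1 S L L' \<longleftrightarrow> (\<exists>i a b u v o1.
     S = {(i, a, b)} \<and> a < b \<and>
     replaces_in_square S {} {ordered_crossing o1 (i, u) (i, v)} L L' \<and>
     inj_on (curve L i) {a..b} \<and>
     {(s, t). a \<le> s \<and> s < t \<and> t \<le> b \<and> curve L' i s = curve L' i t} = {(u, v)})"

text \<open>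
  In the second and third moves the strands run across the square as graphs over \<open>[-1, 1]\<close>.  The
  strand \<open>(i, a, b)\<close> is at abscissa -1 for the parameter \<open>a\<close> and at abscissa 1 for \<open>b\<close>; as either
  of \<open>a < b\<close> and \<open>b < a\<close> is allowed, every choice of orientations of the strands is covered.
\<close>

definition at_abscissa :: "strand \<Rightarrow> real \<Rightarrow> preimage" where
  "at_abscissa = (\<lambda>(i, a, b) x. (i, (1 - x) / 2 * a + (1 + x) / 2 * b))"

definition runs_along :: "diagram \<Rightarrow> strand \<Rightarrow> (real \<Rightarrow> real) \<Rightarrow> bool" where
  "runs_along L \<sigma> f \<longleftrightarrow> (\<forall>x\<in>{- 1..1}. image_point L (at_abscissa \<sigma> x) = Complex x (f x))"

definition graph_crossing :: "bool \<Rightarrow> strand \<Rightarrow> strand \<Rightarrow> real \<Rightarrow> preimage \<times> preimage" where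
  "graph_crossing first_over \<sigma> \<tau> x =
     ordered_crossing first_over (at_abscissa \<sigma> x) (at_abscissa \<tau> x)"

definition reidemeister2 :: "strand set \<Rightarrow> diagram \<Rightarrow> diagram \<Rightarrow> bool" where
  "reidemeister2 S L L' \<longleftrightarrow> (\<exists>\<sigma> \<tau> f g f' g' x y o1.
     S = {\<sigma>, \<tau>} \<and> \<sigma> \<noteq> \<tau> \<and>
     replaces_in_square S {} {graph_crossing o1 \<sigma> \<tau> x, graph_crossing o1 \<sigma> \<tau> y} L L' \<and>
     runs_along L \<sigma> f \<and> runs_along L \<tau> g \<and> runs_along L' \<sigma> f' \<and> runs_along L' \<tau> g' \<and>
     (\<forall>w\<in>{- 1..1}. f w < g w) \<and>
     f' (- 1) < g' (- 1) \<and> f' 1 < g' 1 \<and>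
     x < y \<and> {w\<in>{- 1..1}. f' w = g' w} = {x, y})"

text \<open>Three strands, numbered from bottom to top at abscissa -1, every two of which cross once.\<close>

definition triangle ::
  "diagram \<Rightarrow> strand \<Rightarrow> strand \<Rightarrow> strand \<Rightarrow> real \<Rightarrow> real \<Rightarrow> real \<Rightarrow> bool" where
  "triangle L \<sigma>1 \<sigma>2 \<sigma>3 x12 x13 x23 \<longleftrightarrow> (\<exists>f1 f2 f3.
     runs_along L \<sigma>1 f1 \<and> runs_along L \<sigma>2 f2 \<and> runs_along L \<sigma>3 f3 \<and>
     f1 (- 1) < f2 (- 1) \<and> f2 (- 1) < f3 (- 1) \<and> f3 1 < f2 1 \<and> f2 1 < f1 1 \<and>
     {w\<in>{- 1..1}. f1 w = f2 w} = {x12} \<and>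
     {w\<in>{- 1..1}. f1 w = f3 w} = {x13} \<and>
     {w\<in>{- 1..1}. f2 w = f3 w} = {x23})"

text \<open>\<open>h1\<close>, \<open>h2\<close>, \<open>h3\<close> are the heights of the three strands; higher strands cross over lower ones.\<close>

definition triangle_crossings ::
  "strand \<Rightarrow> strand \<Rightarrow> strand \<Rightarrow> nat \<Rightarrow> nat \<Rightarrow> nat \<Rightarrow> real \<Rightarrow> real \<Rightarrow> real \<Rightarrow> (preimage \<times> preimage) set" where
  "triangle_crossings \<sigma>1 \<sigma>2 \<sigma>3 h1 h2 h3 x12 x13 x23 =
     {graph_crossing (h2 < h1) \<sigma>1 \<sigma>2 x12,
      graph_crossing (h3 < h1) \<sigma>1 \<sigma>3 x13,
      graph_crossing (h3 < h2) \<sigma>2 \<sigma>3 x23}"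

definition reidemeister3 :: "strand set \<Rightarrow> diagram \<Rightarrow> diagram \<Rightarrow> bool" where
  "reidemeister3 S L L' \<longleftrightarrow> (\<exists>\<sigma>1 \<sigma>2 \<sigma>3 h1 h2 h3 x12 x13 x23 y12 y13 y23.
     S = {\<sigma>1, \<sigma>2, \<sigma>3} \<and> distinct [\<sigma>1, \<sigma>2, \<sigma>3] \<and> distinct [h1, h2, h3] \<and>
     replaces_in_square S (triangle_crossings \<sigma>1 \<sigma>2 \<sigma>3 h1 h2 h3 x12 x13 x23)
                          (triangle_crossings \<sigma>1 \<sigma>2 \<sigma>3 h1 h2 h3 y12 y13 y23) L L' \<and>
     triangle L \<sigma>1 \<sigma>2 \<sigma>3 x12 x13 x23 \<and> x12 < x13 \<and> x13 < x23 \<and>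
     triangle L' \<sigma>1 \<sigma>2 \<sigma>3 y12 y13 y23 \<and> y23 < y13 \<and> y13 < y12)"

text \<open>
  The replaced arc of the detour move may run anywhere in the plane.  As \<open>overs\<close> is unchanged and
  does not involve the arc, all crossings on the arc are virtual before and after the move.
\<close>

definition detour :: "strand set \<Rightarrow> diagram \<Rightarrow> diagram \<Rightarrow> bool" where
  "detour S L L' \<longleftrightarrow> (\<exists>\<sigma>. S = {\<sigma>} \<and> proper_strand L \<sigma> \<and> curves_agree_off S L L' \<and>
     overs L' = overs L \<and>
     (\<forall>(p, q)\<in>overs L. p \<notin> closed_strand \<sigma> \<and> q \<notin> closed_strand \<sigma>))"

definition local_move :: "strand set \<Rightarrow> diagram \<Rightarrow> diagram \<Rightarrow> bool" where
  "local_move S L L' \<longleftrightarrow>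
     reidemeister1 S L L' \<or> reidemeister2 S L L' \<or> reidemeister3 S L L' \<or> detour S L L'"

text \<open>
  The colored diagram \<open>(L', C')\<close> is obtained from \<open>(L, C)\<close> by one virtual isotopy move, in either
  direction, or by passing to another representative of the same diagram (planar isotopy,
  reparametrisation).
\<close>

definition obtained_by_move :: "diagram \<Rightarrow> labelling \<Rightarrow> diagram \<Rightarrow> labelling \<Rightarrow> bool" where
  "obtained_by_move L C L' C' \<longleftrightarrow>
     (\<exists>S. (local_move S L L' \<or> local_move S L' L) \<and> labels_agree_off S L C C') \<or>
     planar_isotopic L L' \<and> labels_agree_off {} L C C' \<or>
     (\<exists>\<pi> \<rho>. reparametrised \<pi> \<rho> L L' \<and> (\<forall>i<ncomp L. \<forall>s. C' i s = C (\<pi> i) (\<rho> i s)))"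

end

(*
  The weight of a crossing is half of (incoming + outgoing label of the overstrand) minus
  (incoming + outgoing label of the understrand).  A strand that runs across the square of a move
  changes its label at a crossing by an amount that depends only on the orientation of the other
  strand and on which of the two comes from below.  So the two crossings of a second move have equal
  weights and opposite signs, each crossing of a third move keeps its sign and its weight, and the
  crossing of a first move has weight 0 because the label leaving its first passage is the one
  entering its second.  Planar isotopies preserve signs because the Jacobian determinant never
  vanishes along the isotopy and is 1 at its start.
*)
theory Submission
  imports Defs
begin

section \<open>Crossings in terms of the over- and the undercrossing strand\<close>

text \<open>A strand across the square is described by its labels read from west to east, not along
  its orientation. At a crossing of sign s the overstrand goes from incoming to outgoing label by
  -s, the understrand by +s. Let d and e be the directions (1 eastward, -1 westward) of the two
  strands, and let k record their vertical order. Then s is d * e * k up to a factor saying which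
  strand is over, and this factor cancels in the change of either label. Reading the change of the
  first strand eastward multiplies it by d, and d * d = 1 leaves e * k. The sum of incoming and
  outgoing label is the sum of west and east label for either direction. So all orientations are
  treated at once, and weights are compared after doubling. Analysis enters through s: a classical
  crossing is transversal, so the slopes of the two graphs differ there, and the order of the graphs
  on one side tells which is larger. Off the site, tangents are derivatives, so the curves must
  agree on a neighbourhood of the parameter, even at the base point.\<close>

definition crossing_term :: "diagram \<Rightarrow> labelling \<Rightarrow> preimage \<times> preimage \<Rightarrow> int fls" where
  "crossing_term L C c = of_int (crossing_sign L c) * (fls_X_intpow (weight L C c) - 1)"

lemma cheng_poly_eq_sum: "cheng_poly L C = (\<Sum>c\<in>overs L. crossing_term L C c)"
  by (simp add: cheng_poly_def crossing_term_def)

text \<open>In terms of over and under, instead of left and right, both signs give one formula. For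
  a Cheng coloring it is the outgoing label of the overstrand minus the incoming label of the
  understrand.\<close>

lemma weight_eq:
  "weight L C c = incoming_label C (fst c) - incoming_label C (snd c) - crossing_sign L c"
  by (simp add: weight_def weight_plus_def weight_minus_def left_incoming_def right_incoming_def
      crossing_sign_def)

text \<open>The overstrand is the left incoming one at a positive crossing and loses 1; it is the
  right incoming one at a negative crossing and gains 1.\<close>

lemma outgoing_labels:
  assumes "cheng_coloring L C" "c \<in> overs L"
  shows "has_outgoing_label C (fst c) (incoming_label C (fst c) - crossing_sign L c)"
    and "has_outgoing_label C (snd c) (incoming_label C (snd c) + crossing_sign L c)"
proof -
  have "has_outgoing_label C (left_incoming L c) (incoming_label C (left_incoming L c) - 1)"
    "has_outgoing_label C (right_incoming L c) (incoming_label C (right_incoming L c) + 1)"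
    using assms by (simp_all add: cheng_coloring_def)
  then show "has_outgoing_label C (fst c) (incoming_label C (fst c) - crossing_sign L c)"
    and "has_outgoing_label C (snd c) (incoming_label C (snd c) + crossing_sign L c)"
    by (simp_all add: left_incoming_def right_incoming_def crossing_sign_def split: if_splits)
qed

lemma crossing_term_cong:
  assumes "crossing_sign L' c' = crossing_sign L c"
    and "incoming_label C' (fst c') = incoming_label C (fst c)"
    and "incoming_label C' (snd c') = incoming_label C (snd c)"
  shows "crossing_term L' C' c' = crossing_term L C c"
  using assms by (simp add: crossing_term_def weight_eq)

text \<open>The factor \<open>k\<close> will be a Jacobian determinant or the product of the two
  speeds of a reparametrisation.\<close>

lemma crossing_sign_cong:
  assumes "cross2 (tangent L' (fst c')) (tangent L' (snd c')) =
             k * cross2 (tangent L (fst c)) (tangent L (snd c))" "k > 0"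
  shows "crossing_sign L' c' = crossing_sign L c"
  using assms by (simp add: crossing_sign_def zero_less_mult_iff)

lemma cross2_swap: "cross2 v u = - cross2 u v"
  by (simp add: cross2_def)

lemma arc_labelling_eq:
  assumes "arc_labelling L C" "i < ncomp L" "s < t"
    and "\<And>u. s \<le> u \<Longrightarrow> u < t \<Longrightarrow> \<not> classical_at L i u"
  shows "C i s = C i t"
proof -
  have "\<forall>s t. s < t \<and> (\<forall>u\<in>{s..<t}. \<not> classical_at L i u) \<longrightarrow> C i s = C i t"
    using assms(1,2) by (simp add: arc_labelling_def)
  from this[rule_format, of s t] show ?thesis
    using assms(3,4) by simp
qed

lemma virtual_link_diagramD:
  assumes "virtual_link_diagram L"
  shows "finite (double_points L)" "overs L \<subseteq> double_points L"
    "\<forall>i<ncomp L. closed_immersion (curve L i)"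
    "\<forall>(p, q)\<in>double_points L. cross2 (tangent L p) (tangent L q) \<noteq> 0"
  using assms unfolding virtual_link_diagram_def by - (elim conjE, assumption)+

lemma finite_overs: "virtual_link_diagram L \<Longrightarrow> finite (overs L)"
  by (rule finite_subset[OF virtual_link_diagramD(2,1)])

lemma overs_double_points: "virtual_link_diagram L \<Longrightarrow> c \<in> overs L \<Longrightarrow> c \<in> double_points L"
  by (rule subsetD[OF virtual_link_diagramD(2)])

lemma overs_preimages:
  assumes "virtual_link_diagram L" "c \<in> overs L"
  shows "fst c \<in> preimages L" "snd c \<in> preimages L"
  using overs_double_points[OF assms] by (simp_all add: double_points_def case_prod_beta)

lemma overs_transversal:
  assumes "virtual_link_diagram L" "c \<in> overs L"
  shows "cross2 (tangent L (fst c)) (tangent L (snd c)) \<noteq> 0"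
  using bspec[OF virtual_link_diagramD(4)[OF assms(1)] overs_double_points[OF assms]]
  by (simp add: case_prod_beta)

lemma curve_periodic:
  "virtual_link_diagram L \<Longrightarrow> i < ncomp L \<Longrightarrow> curve L i (s + 1) = curve L i s"
  using virtual_link_diagramD(3)[of L] by (simp add: closed_immersion_def)

lemma curve_has_vector_derivative:
  assumes "virtual_link_diagram L" "i < ncomp L"
  shows "(curve L i has_vector_derivative vector_derivative (curve L i) (at s)) (at s)"
proof -
  have "curve L i C1_differentiable_on UNIV"
    using virtual_link_diagramD(3)[OF assms(1)] assms(2) by (simp add: closed_immersion_def)
  then show ?thesis
    by (simp add: C1_differentiable_on_eq vector_derivative_works)
qed

section \<open>Periodic functions and their derivatives\<close>

lemma periodic_add_int:
  fixes f :: "real \<Rightarrow> 'a"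
  assumes "\<And>s. f (s + 1) = f s"
  shows "f (s + of_int n) = f s"
proof (induction n rule: int_induct[where k = 0])
  case base
  show ?case by simp
next
  case (step1 i)
  show ?case using assms[of "s + of_int i"] step1 by (simp add: add.assoc)
next
  case (step2 i)
  show ?case using assms[of "s + of_int (i - 1)"] step2 by (simp add: add.assoc)
qed

lemma periodic_frac:
  fixes f :: "real \<Rightarrow> 'a"
  assumes "\<And>s. f (s + 1) = f s"
  shows "f (frac s) = f s"
  using periodic_add_int[of f "frac s" "\<lfloor>s\<rfloor>", OF assms] by (simp add: frac_def)

text \<open>\<open>vector_derivative\<close> is a choice from the set of derivatives, so this set is
  shown to be the same at both points; the shifts by 1 and by -1 give the two inclusions.\<close>

lemma vector_derivative_periodic:
  fixes f :: "real \<Rightarrow> 'a::real_normed_vector"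
  assumes "\<And>s. f (s + 1) = f s"
  shows "vector_derivative f (at (s + 1)) = vector_derivative f (at s)"
proof -
  have shift: "(f has_vector_derivative d) (at t)"
    if "(f has_vector_derivative d) (at (t + c))" "\<And>x. f (x + c) = f x" for c d t
  proof -
    have "(f \<circ> (\<lambda>x. x + c) has_vector_derivative 1 *\<^sub>R d) (at t)"
      using that(1) by (intro vector_diff_chain_at) (auto intro!: derivative_eq_intros)
    moreover have "f \<circ> (\<lambda>x. x + c) = f"
      using that(2) by auto
    ultimately show ?thesis by simp
  qed
  have "f (x + - 1) = f x" for x
    using assms[of "x - 1"] by simp
  then have "(f has_vector_derivative d) (at (s + 1)) \<longleftrightarrow> (f has_vector_derivative d) (at s)" for d
    using shift[of d s 1] shift[of d "s + 1" "- 1"] assms by auto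
  then show ?thesis
    by (simp add: vector_derivative_def)
qed


section \<open>Planar isotopy\<close>

text \<open>\<open>cross2 (A 1) (A \<i>)\<close> is the determinant of \<open>A\<close>; expand both
  arguments in the basis 1, \<open>\<i>\<close>.\<close>

lemma cross2_linear:
  assumes "linear A"
  shows "cross2 (A u) (A v) = cross2 (A 1) (A \<i>) * cross2 u v"
proof -
  have *: "A w = Re w *\<^sub>R A 1 + Im w *\<^sub>R A \<i>" for w
  proof -
    have "w = Re w *\<^sub>R 1 + Im w *\<^sub>R \<i>" by (simp add: complex_eq_iff)
    then have "A w = A (Re w *\<^sub>R 1 + Im w *\<^sub>R \<i>)" by simp
    then show ?thesis using assms by (simp only: linear_add linear_scale)
  qed
  show ?thesis
    unfolding *[of u] *[of v] by (simp add: cross2_def algebra_simps)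
qed

text \<open>If \<open>A\<close> maps \<open>u\<close>, \<open>v\<close> to the basis 1,
  \<open>\<i>\<close>, then its determinant times \<open>cross2 u v\<close> is 1.\<close>

lemma cross2_bij_linear:
  assumes "linear A" "bij A"
  shows "cross2 (A 1) (A \<i>) \<noteq> 0"
proof -
  obtain u v where "A u = 1" "A v = \<i>"
    using assms(2) by (metis bij_pointE)
  then have "cross2 1 \<i> = cross2 (A 1) (A \<i>) * cross2 u v"
    using cross2_linear[OF assms(1), of u v] by simp
  then show ?thesis
    by (auto simp: cross2_def)
qed

lemma ambient_isotopy_orientation_preserving:
  assumes "ambient_isotopy H"
  obtains A where "(H 1 has_derivative A) (at z)" "linear A" "cross2 (A 1) (A \<i>) > 0"
proof -
  obtain D :: "real \<Rightarrow> complex \<Rightarrow> complex \<Rightarrow>\<^sub>L complex" where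
    cont: "continuous_on ({0..1} \<times> UNIV) (\<lambda>(t, z). D t z)" and
    D: "\<And>t z. t \<in> {0..1} \<Longrightarrow> (H t has_derivative blinfun_apply (D t z)) (at z)" and
    bij: "\<And>t z. t \<in> {0..1} \<Longrightarrow> bij (blinfun_apply (D t z))" and
    H0: "\<And>z. H 0 z = z"
    using assms unfolding ambient_isotopy_def by blast
  define d where "d t = cross2 (blinfun_apply (D t z) 1) (blinfun_apply (D t z) \<i>)" for t
  have lin: "linear (blinfun_apply (D t z))" for t
    by (rule bounded_linear.linear[OF blinfun.bounded_linear_right])
  have "continuous_on {0..1} (\<lambda>t. (\<lambda>(t, z). D t z) (t, z))"
    by (rule continuous_on_compose2[OF cont]) (auto intro!: continuous_intros)
  then have contD: "continuous_on {0..1} (\<lambda>t. D t z)"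
    by simp
  have contd: "continuous_on {0..1} d"
    unfolding d_def cross2_def by (intro continuous_intros contD)
  \<comment> \<open>\<open>ambient_isotopy\<close> does not prescribe \<open>D 0\<close>; uniqueness
    of the derivative of \<open>H 0\<close> makes it the identity.\<close>
  have "H 0 = (\<lambda>z. z)"
    using H0 by auto
  then have "((\<lambda>z. z) has_derivative blinfun_apply (D 0 z)) (at z)"
    using D[of 0 z] by simp
  then have "blinfun_apply (D 0 z) = (\<lambda>z. z)"
    using has_derivative_unique has_derivative_ident by blast
  then have d0: "d 0 > 0"
    by (simp add: d_def cross2_def)
  have nz: "d t \<noteq> 0" if "t \<in> {0..1}" for t
    unfolding d_def by (rule cross2_bij_linear[OF lin bij[OF that]])
  have "d 1 > 0"
  proof (rule ccontr)
    assume "\<not> d 1 > 0"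
    then have "\<exists>t\<ge>0. t \<le> 1 \<and> d t = 0"
      by (intro IVT2') (use d0 contd in auto)
    then show False
      using nz by auto
  qed
  then show ?thesis
    using that[of "blinfun_apply (D 1 z)"] D[of 1 z] lin by (simp add: d_def)
qed

lemma cheng_poly_planar_isotopic:
  assumes L: "virtual_link_diagram L" and iso: "planar_isotopic L L'"
    and lab: "labels_agree_off {} L C C'"
  shows "cheng_poly L' C' = cheng_poly L C"
proof -
  obtain H where H: "ambient_isotopy H"
    and curve: "\<And>i s. i < ncomp L \<Longrightarrow> curve L' i s = H 1 (curve L i s)"
    and overs: "overs L' = overs L"
    using iso unfolding planar_isotopic_def by blast
  have "crossing_term L' C' c = crossing_term L C c" if c: "c \<in> overs L" for c
  proof -
    define z where "z = image_point L (fst c)"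
    have z: "image_point L (snd c) = z"
      using overs_double_points[OF L c] by (simp add: z_def double_points_def case_prod_beta)
    obtain A where A: "(H 1 has_derivative A) (at z)" "linear A" "cross2 (A 1) (A \<i>) > 0"
      using ambient_isotopy_orientation_preserving[OF H] .
    \<comment> \<open>Both passages of the crossing lie at \<open>z\<close>, so the same linear map
      \<open>A\<close> transforms both tangents.\<close>
    have tangent: "tangent L' p = A (tangent L p)"
      if p: "p \<in> preimages L" "image_point L p = z" for p
    proof -
      have i: "fst p < ncomp L"
        using p by (auto simp: preimages_def)
      have eq: "curve L' (fst p) = H 1 \<circ> curve L (fst p)"
        using curve[OF i] by auto
      have "(H 1 \<circ> curve L (fst p) has_derivative
              A \<circ> (\<lambda>x. x *\<^sub>R tangent L p)) (at (snd p))"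
        using curve_has_vector_derivative[OF L i, of "snd p"] A(1) p(2)
        by (intro diff_chain_at) (simp_all add: has_vector_derivative_def tangent_def image_point_def)
      then have "(curve L' (fst p) has_vector_derivative A (tangent L p)) (at (snd p))"
        using A(2) by (simp add: has_vector_derivative_def eq o_def linear_scale)
      then show ?thesis
        by (simp add: tangent_def vector_derivative_at)
    qed
    have "tangent L' (fst c) = A (tangent L (fst c))" "tangent L' (snd c) = A (tangent L (snd c))"
      using overs_preimages[OF L c] z by (simp_all add: tangent z_def)
    then have "crossing_sign L' c = crossing_sign L c"
      using cross2_linear[OF A(2), of "tangent L (fst c)" "tangent L (snd c)"] A(3)
      by (intro crossing_sign_cong) simp_all
    moreover have "incoming_label C' p = incoming_label C p" if "p \<in> preimages L" for p
      using lab that by (auto simp: labels_agree_off_def incoming_label_def)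
    ultimately show ?thesis
      using overs_preimages[OF L c] by (intro crossing_term_cong) simp_all
  qed
  then show ?thesis
    by (simp add: cheng_poly_eq_sum overs)
qed


section \<open>Reparametrisation\<close>

text \<open>\<open>r\<close> is the lift of an orientation preserving homeomorphism of the circle.
  Injectivity: equal fractional parts would put \<open>r s\<close> and \<open>r t\<close> at an
  integer distance, but this distance lies strictly between 0 and 1.\<close>

lemma lift_frac_bij:
  fixes r :: "real \<Rightarrow> real"
  assumes cont: "continuous_on UNIV r" and mono: "strict_mono r" and per: "\<And>s. r (s + 1) = r s + 1"
  shows "bij_betw (\<lambda>s. frac (r s)) {0..<1} {0..<1}"
proof (rule bij_betw_imageI)
  have *: "frac (r s) \<noteq> frac (r t)" if "0 \<le> s" "s < t" "t < 1" for s t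
  proof
    assume "frac (r s) = frac (r t)"
    then have "r t - r s = of_int (\<lfloor>r t\<rfloor> - \<lfloor>r s\<rfloor>)"
      by (simp add: frac_def algebra_simps)
    moreover have "r s < r t" "r t < r s + 1"
      using strict_monoD[OF mono, of s t] strict_monoD[OF mono, of t "s + 1"] per[of s] that by auto
    ultimately have "0 < \<lfloor>r t\<rfloor> - \<lfloor>r s\<rfloor>" "\<lfloor>r t\<rfloor> - \<lfloor>r s\<rfloor> < 1"
      by linarith+
    then show False
      by linarith
  qed
  show "inj_on (\<lambda>s. frac (r s)) {0..<1}"
    by (rule linorder_inj_onI) (use * in auto)
  show "(\<lambda>s. frac (r s)) ` {0..<1} = {0..<1}"
  proof (intro equalityI subsetI)
    fix y :: real
    assume y: "y \<in> {0..<1}"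
    \<comment> \<open>The integer that moves \<open>y\<close> into the half-open interval from
      \<open>r 0\<close> to \<open>r 1 = r 0 + 1\<close>. As its right end is excluded, the solution
      \<open>s\<close> is not 1.\<close>
    define n where "n = \<lceil>r 0 - y\<rceil>"
    have n: "r 0 \<le> y + of_int n" "y + of_int n < r 0 + 1"
      unfolding n_def by linarith+
    have "\<exists>s\<ge>0. s \<le> 1 \<and> r s = y + of_int n"
      using n per[of 0] cont continuous_on_subset by (intro IVT') auto
    then obtain s where s: "0 \<le> s" "s \<le> 1" "r s = y + of_int n"
      by blast
    have "s \<noteq> 1"
      using s n per[of 0] by auto
    moreover have "frac (r s) = y"
      using s y by (simp add: frac_unique_iff)
    ultimately show "y \<in> (\<lambda>s. frac (r s)) ` {0..<1}"
      using s by (intro image_eqI[of _ _ s]) auto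
  qed (auto simp: frac_lt_1)
qed

lemma cheng_poly_reparametrised:
  assumes L: "virtual_link_diagram L" and C: "cheng_coloring L C"
    and L': "virtual_link_diagram L'"
    and rep: "reparametrised \<pi> \<rho> L L'"
    and lab: "\<And>i s. i < ncomp L \<Longrightarrow> C' i s = C (\<pi> i) (\<rho> i s)"
  shows "cheng_poly L' C' = cheng_poly L C"
proof -
  have n: "ncomp L' = ncomp L" and \<pi>: "bij_betw \<pi> {..<ncomp L} {..<ncomp L}"
    using rep by (auto simp: reparametrised_def)
  have \<rho>: "\<rho> i C1_differentiable_on UNIV" "vector_derivative (\<rho> i) (at s) > 0"
    "\<rho> i (s + 1) = \<rho> i s + 1" "curve L' i s = curve L (\<pi> i) (\<rho> i s)" if "i < ncomp L" for i s
    using rep that by (auto simp: reparametrised_def)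
  have \<pi>_less: "\<pi> i < ncomp L" if "i < ncomp L" for i
    using bij_betwE[OF \<pi>] that by auto
  have d\<rho>: "(\<rho> i has_vector_derivative vector_derivative (\<rho> i) (at s)) (at s)"
    if "i < ncomp L" for i s
    using \<rho>(1)[OF that] by (simp add: C1_differentiable_on_eq vector_derivative_works)
  \<comment> \<open>Sends a preimage point of \<open>L'\<close> to the corresponding one of
    \<open>L\<close>; \<open>frac\<close> brings the parameter back to the fundamental
    domain.\<close>
  define \<phi> where "\<phi> p = (\<pi> (fst p), frac (\<rho> (fst p) (snd p)))" for p
  have bij\<rho>: "bij_betw (\<lambda>s. frac (\<rho> i s)) {0..<1} {0..<1}" if i: "i < ncomp L" for i
  proof (rule lift_frac_bij)
    show "continuous_on UNIV (\<rho> i)"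
      using \<rho>(1)[OF i] C1_differentiable_imp_continuous_on by blast
    show "strict_mono (\<rho> i)"
    proof (rule strict_monoI)
      fix s t :: real
      assume "s < t"
      then show "\<rho> i s < \<rho> i t"
      proof (rule DERIV_pos_imp_increasing)
        fix x
        show "\<exists>y. (\<rho> i has_real_derivative y) (at x) \<and> 0 < y"
          using d\<rho>[OF i, of x] \<rho>(2)[OF i, of x]
          by (auto simp: has_real_derivative_iff_has_vector_derivative)
      qed
    qed
  qed (use \<rho>(3)[OF i] in auto)
  have bij\<phi>: "bij_betw \<phi> (preimages L') (preimages L)"
  proof (rule bij_betw_imageI)
    show "inj_on \<phi> (preimages L')"
    proof (rule inj_onI)
      fix p q
      assume p: "p \<in> preimages L'" and q: "q \<in> preimages L'" and eq: "\<phi> p = \<phi> q"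
      have pq: "fst p < ncomp L" "fst q < ncomp L" "snd p \<in> {0..<1}" "snd q \<in> {0..<1}"
        using p q n by (auto simp: preimages_def)
      have "\<pi> (fst p) = \<pi> (fst q)"
        using eq by (simp add: \<phi>_def)
      then have 1: "fst p = fst q"
        using bij_betw_imp_inj_on[OF \<pi>] pq by (auto dest: inj_onD)
      then have "frac (\<rho> (fst p) (snd p)) = frac (\<rho> (fst p) (snd q))"
        using eq by (simp add: \<phi>_def)
      then have "snd p = snd q"
        using bij_betw_imp_inj_on[OF bij\<rho>[OF pq(1)]] pq by (auto dest: inj_onD)
      with 1 show "p = q"
        by (simp add: prod_eq_iff)
    qed
    show "\<phi> ` preimages L' = preimages L"
    proof (intro equalityI subsetI)
      fix p
      assume "p \<in> \<phi> ` preimages L'"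
      then show "p \<in> preimages L"
        using n \<pi>_less by (auto simp: \<phi>_def preimages_def frac_lt_1)
    next
      fix p
      assume "p \<in> preimages L"
      then have p: "fst p < ncomp L" "snd p \<in> {0..<1}"
        by (auto simp: preimages_def)
      obtain i where i: "i < ncomp L" "fst p = \<pi> i"
        using bij_betw_imp_surj_on[OF \<pi>] p(1) by blast
      obtain s where s: "s \<in> {0..<1}" "snd p = frac (\<rho> i s)"
        using bij_betw_imp_surj_on[OF bij\<rho>[OF i(1)]] p(2) by blast
      show "p \<in> \<phi> ` preimages L'"
        using i s n by (intro image_eqI[of _ _ "(i, s)"]) (auto simp: \<phi>_def preimages_def prod_eq_iff)
    qed
  qed
  have overs: "overs L' = {c \<in> preimages L' \<times> preimages L'. map_prod \<phi> \<phi> c \<in> overs L}"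
  proof -
    have "overs L' = {((i, s), (j, t)) | i s j t.
                   (i, s) \<in> preimages L' \<and> (j, t) \<in> preimages L' \<and>
                   ((\<pi> i, frac (\<rho> i s)), (\<pi> j, frac (\<rho> j t))) \<in> overs L}"
      using rep by (simp add: reparametrised_def)
    also have "\<dots> = {c \<in> preimages L' \<times> preimages L'. map_prod \<phi> \<phi> c \<in> overs L}"
      by (auto simp: \<phi>_def)
    finally show ?thesis .
  qed
  have bij: "bij_betw (map_prod \<phi> \<phi>) (overs L') (overs L)"
  proof (rule bij_betw_imageI)
    have inj: "inj_on (map_prod \<phi> \<phi>) (preimages L' \<times> preimages L')"
      using bij\<phi> by (intro map_prod_inj_on) (auto dest: bij_betw_imp_inj_on)
    show "inj_on (map_prod \<phi> \<phi>) (overs L')"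
      by (rule inj_on_subset[OF inj]) (auto simp: overs)
    show "map_prod \<phi> \<phi> ` overs L' = overs L"
    proof (intro equalityI subsetI)
      fix c
      assume c: "c \<in> overs L"
      have "fst c \<in> \<phi> ` preimages L'" "snd c \<in> \<phi> ` preimages L'"
        using bij_betw_imp_surj_on[OF bij\<phi>] overs_preimages[OF L c] by simp_all
      then obtain p q where "p \<in> preimages L'" "q \<in> preimages L'" "fst c = \<phi> p" "snd c = \<phi> q"
        by (elim imageE) (rule that)
      then have "p \<in> preimages L'" "q \<in> preimages L'" "c = map_prod \<phi> \<phi> (p, q)"
        by (simp_all add: prod_eq_iff del: split_paired_All)
      then show "c \<in> map_prod \<phi> \<phi> ` overs L'"
        using c by (intro image_eqI[of _ _ "(p, q)"]) (simp_all add: overs)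
    qed (auto simp: overs)
  qed
  have "crossing_term L' C' c = crossing_term L C (map_prod \<phi> \<phi> c)" if c: "c \<in> overs L'" for c
  proof -
    \<comment> \<open>The derivative of a periodic curve is periodic, so \<open>frac\<close> may be
      dropped; the chain rule then produces the positive speed of \<open>\<rho>\<close> as
      factor.\<close>
    have tangent: "tangent L' p = vector_derivative (\<rho> (fst p)) (at (snd p)) *\<^sub>R tangent L (\<phi> p)"
      if p: "p \<in> preimages L'" for p
    proof -
      have i: "fst p < ncomp L"
        using p n by (auto simp: preimages_def)
      have eq: "curve L' (fst p) = curve L (\<pi> (fst p)) \<circ> \<rho> (fst p)"
        using \<rho>(4)[OF i] by auto
      have "vector_derivative (curve L (\<pi> (fst p))) (at (frac (\<rho> (fst p) (snd p)))) =
            vector_derivative (curve L (\<pi> (fst p))) (at (\<rho> (fst p) (snd p)))"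
        using curve_periodic[OF L \<pi>_less[OF i]]
        by (intro periodic_frac vector_derivative_periodic)
      moreover have "(curve L (\<pi> (fst p)) \<circ> \<rho> (fst p) has_vector_derivative
          vector_derivative (\<rho> (fst p)) (at (snd p)) *\<^sub>R
            vector_derivative (curve L (\<pi> (fst p))) (at (\<rho> (fst p) (snd p)))) (at (snd p))"
        using d\<rho>[OF i] curve_has_vector_derivative[OF L \<pi>_less[OF i]]
        by (intro vector_diff_chain_at)
      ultimately show ?thesis
        by (simp add: tangent_def eq \<phi>_def vector_derivative_at)
    qed
    have label: "incoming_label C' p = incoming_label C (\<phi> p)" if p: "p \<in> preimages L'" for p
    proof -
      have i: "fst p < ncomp L"
        using p n by (auto simp: preimages_def)
      have "C (\<pi> (fst p)) (s + 1) = C (\<pi> (fst p)) s" for s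
        using C \<pi>_less[OF i] by (auto simp: cheng_coloring_def arc_labelling_def)
      then show ?thesis
        by (simp add: incoming_label_def \<phi>_def lab[OF i] periodic_frac)
    qed
    have pre: "fst c \<in> preimages L'" "snd c \<in> preimages L'"
      using overs_preimages[OF L' c] .
    then have "crossing_sign L' c = crossing_sign L (map_prod \<phi> \<phi> c)"
      using \<rho>(2) n
      by (intro crossing_sign_cong[where k = "vector_derivative (\<rho> (fst (fst c))) (at (snd (fst c))) *
            vector_derivative (\<rho> (fst (snd c))) (at (snd (snd c)))"])
         (auto simp: tangent cross2_def algebra_simps preimages_def fst_map_prod snd_map_prod)
    then show ?thesis
      using pre by (intro crossing_term_cong) (auto simp: label fst_map_prod snd_map_prod)
  qed
  then have "cheng_poly L' C' = (\<Sum>c\<in>overs L'. crossing_term L C (map_prod \<phi> \<phi> c))"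
    by (simp add: cheng_poly_eq_sum)
  also have "\<dots> = cheng_poly L C"
    unfolding cheng_poly_eq_sum by (rule sum.reindex_bij_betw[OF bij])
  finally show ?thesis .
qed


section \<open>Crossings away from the site of a move\<close>

text \<open>A tangent is determined by the curve near \<open>s\<close>. The closed parameter
  intervals of the strands on this component form a closed set \<open>K\<close> inside (0, 1), so a
  neighbourhood of \<open>s\<close> avoids it. At \<open>s = 0\<close> this neighbourhood contains
  negative parameters \<open>u\<close>, where periodicity passes to \<open>u + 1\<close>; hence the
  conditions on \<open>u + 1\<close> and \<open>s + 1\<close>.\<close>

lemma tangent_agree_off:
  assumes L: "virtual_link_diagram L" and L': "virtual_link_diagram L'"
    and S: "finite S" "\<And>\<sigma>. \<sigma> \<in> S \<Longrightarrow> proper_strand L \<sigma>" and agree: "curves_agree_off S L L'"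
    and p: "p \<in> preimages L" "p \<notin> (\<Union>\<sigma>\<in>S. closed_strand \<sigma>)"
  shows "tangent L' p = tangent L p"
proof -
  obtain j s where js: "p = (j, s)"
    by fastforce
  have j: "j < ncomp L" and s: "0 \<le> s" "s < 1"
    using p(1) by (auto simp: js preimages_def)
  have n: "ncomp L' = ncomp L"
    using agree by (simp add: curves_agree_off_def)
  define K where "K = (\<Union>\<sigma>\<in>{\<sigma>\<in>S. fst \<sigma> = j}. closed_segment (fst (snd \<sigma>)) (snd (snd \<sigma>)))"
  have K_strand: "u \<in> K" if "(j, u) \<in> closed_strand \<sigma>" "\<sigma> \<in> S" for u \<sigma>
    using that by (force simp: K_def closed_strand_def)
  have "K \<subseteq> {0<..<1}"
  proof
    fix u
    assume "u \<in> K"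
    then obtain i a b where "(i, a, b) \<in> S" "u \<in> closed_segment a b"
      by (auto simp: K_def)
    with S(2) show "u \<in> {0<..<1}"
      by (fastforce simp: proper_strand_def closed_segment_eq_real_ivl split: if_splits)
  qed
  then have "s + 1 \<notin> K"
    using s by auto
  have "s \<notin> K"
    using p(2) by (force simp: K_def js closed_strand_def)
  have "closed K"
    unfolding K_def using S(1) by (intro closed_UN) auto
  then have open1: "open (- K)" and open2: "open ((\<lambda>u. u + 1) -` (- K))"
    by (auto intro!: open_vimage continuous_intros)
  have agree_at: "curve L' j u = curve L j u" if "u \<in> {0..<1}" "u \<notin> K" for u
  proof -
    have "(j, u) \<notin> open_strand \<sigma>" if "\<sigma> \<in> S" for \<sigma>
      using K_strand[of u \<sigma>] that \<open>u \<notin> K\<close> segment_open_subset_closed[of "fst (snd \<sigma>)" "snd (snd \<sigma>)"]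
      by (auto simp: open_strand_def closed_strand_def split: prod.splits)
    then have "(j, u) \<in> preimages L - (\<Union>\<sigma>\<in>S. open_strand \<sigma>)"
      using that j by (auto simp: preimages_def)
    then have "image_point L' (j, u) = image_point L (j, u)"
      using agree unfolding curves_agree_off_def by blast
    then show ?thesis
      by (simp add: image_point_def)
  qed
  have "\<forall>\<^sub>F u in nhds s. u \<in> - K"
    by (rule eventually_nhds_in_open[OF open1]) (simp add: \<open>s \<notin> K\<close>)
  moreover have "\<forall>\<^sub>F u in nhds s. u \<in> (\<lambda>u. u + 1) -` (- K)"
    by (rule eventually_nhds_in_open[OF open2]) (simp add: \<open>s + 1 \<notin> K\<close>)
  moreover have "\<forall>\<^sub>F u in nhds s. u \<in> {-1<..<1}"
    by (rule eventually_nhds_in_open) (use s in simp_all)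
  ultimately have "\<forall>\<^sub>F u in nhds s. curve L' j u = curve L j u"
  proof eventually_elim
    case (elim u)
    show ?case
    proof (cases "u \<ge> 0")
      case True
      with elim show ?thesis by (intro agree_at) auto
    next
      case False
      with elim have "curve L' j (u + 1) = curve L j (u + 1)" by (intro agree_at) auto
      then show ?thesis
        using curve_periodic[OF L j] curve_periodic[OF L'] j n by simp
    qed
  qed
  then have "vector_derivative (curve L' j) (at s within UNIV) =
             vector_derivative (curve L j) (at s within UNIV)"
    by (intro vector_derivative_cong_eq) (auto simp: eventually_mono)
  then show ?thesis
    by (simp add: tangent_def js)
qed

lemma open_strand_subset_closed_strand: "open_strand \<sigma> \<subseteq> closed_strand \<sigma>"
  by (simp add: open_strand_def closed_strand_def case_prod_beta Sigma_mono segment_open_subset_closed)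

text \<open>Signs are read from tangents and weights from incoming labels, and a move changes
  neither off its strands.\<close>

lemma crossing_term_agree_off:
  assumes L: "virtual_link_diagram L" and L': "virtual_link_diagram L'"
    and S: "finite S" "\<And>\<sigma>. \<sigma> \<in> S \<Longrightarrow> proper_strand L \<sigma>"
    and agree: "curves_agree_off S L L'" "labels_agree_off S L C C'"
    and c: "c \<in> overs L" "fst c \<notin> (\<Union>\<sigma>\<in>S. closed_strand \<sigma>)" "snd c \<notin> (\<Union>\<sigma>\<in>S. closed_strand \<sigma>)"
  shows "crossing_term L' C' c = crossing_term L C c"
proof -
  note pre = overs_preimages[OF L c(1)]
  have "incoming_label C' p = incoming_label C p"
    if "p \<in> preimages L" "p \<notin> (\<Union>\<sigma>\<in>S. closed_strand \<sigma>)" for p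
  proof -
    have "p \<in> preimages L - (\<Union>\<sigma>\<in>S. open_strand \<sigma>)"
      using that open_strand_subset_closed_strand by blast
    then show ?thesis
      using agree(2) by (auto simp: labels_agree_off_def incoming_label_def)
  qed
  then show ?thesis
    using pre c tangent_agree_off[OF L L' S agree(1)]
    by (intro crossing_term_cong) (auto simp: crossing_sign_def)
qed

text \<open>No classical crossing lies on the replaced arc, so every term survives by
  itself.\<close>

lemma cheng_poly_detour:
  assumes L: "virtual_link_diagram L" and L': "virtual_link_diagram L'"
    and move: "detour S L L'" and lab: "labels_agree_off S L C C'"
  shows "cheng_poly L' C' = cheng_poly L C"
proof -
  obtain \<sigma> where \<sigma>: "S = {\<sigma>}" "proper_strand L \<sigma>" "curves_agree_off S L L'" "overs L' = overs L"
    and off: "\<And>p q. (p, q) \<in> overs L \<Longrightarrow> p \<notin> closed_strand \<sigma> \<and> q \<notin> closed_strand \<sigma>"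
    using move unfolding detour_def by blast
  have "crossing_term L' C' c = crossing_term L C c" if "c \<in> overs L" for c
    using that off[of "fst c" "snd c"] \<sigma>(1,2)
    by (intro crossing_term_agree_off[OF L L' _ _ \<sigma>(3) lab]) auto
  then show ?thesis
    by (simp add: cheng_poly_eq_sum \<sigma>(4))
qed

section \<open>Reduction of a Reidemeister move to the crossings in the square\<close>

lemma replaces_in_squareE:
  assumes "replaces_in_square S X X' L L'"
  obtains R where "ncomp L' = ncomp L" "curves_agree_off S L L'"
    "\<And>\<sigma>. \<sigma> \<in> S \<Longrightarrow> proper_strand L \<sigma>"
    "\<And>\<sigma> \<tau>. \<sigma> \<in> S \<Longrightarrow> \<tau> \<in> S \<Longrightarrow> \<sigma> \<noteq> \<tau> \<Longrightarrow> closed_strand \<sigma> \<inter> closed_strand \<tau> = {}"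
    "overs L = R \<union> X" "overs L' = R \<union> X'"
    "\<And>c. c \<in> R \<Longrightarrow> fst c \<notin> (\<Union>\<sigma>\<in>S. closed_strand \<sigma>) \<and> snd c \<notin> (\<Union>\<sigma>\<in>S. closed_strand \<sigma>)"
proof -
  have agree: "curves_agree_off S L L'"
    and proper: "\<forall>\<sigma>\<in>S. proper_strand L \<sigma>"
    and disj: "\<forall>\<sigma>\<in>S. \<forall>\<tau>\<in>S. \<sigma> \<noteq> \<tau> \<longrightarrow> closed_strand \<sigma> \<inter> closed_strand \<tau> = {}"
    and ex: "\<exists>R. (\<forall>(p, q)\<in>R. p \<notin> (\<Union>\<sigma>\<in>S. closed_strand \<sigma>) \<and> q \<notin> (\<Union>\<sigma>\<in>S. closed_strand \<sigma>)) \<and>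
          overs L = R \<union> X \<and> overs L' = R \<union> X'"
    using assms unfolding replaces_in_square_def by - (elim conjE, assumption)+
  obtain R where R: "\<forall>(p, q)\<in>R. p \<notin> (\<Union>\<sigma>\<in>S. closed_strand \<sigma>) \<and> q \<notin> (\<Union>\<sigma>\<in>S. closed_strand \<sigma>)"
    "overs L = R \<union> X" "overs L' = R \<union> X'"
    using ex by (elim exE conjE)
  show ?thesis
  proof (rule that[of R])
    show "ncomp L' = ncomp L"
      using agree by (simp add: curves_agree_off_def)
    show "fst c \<notin> (\<Union>\<sigma>\<in>S. closed_strand \<sigma>) \<and> snd c \<notin> (\<Union>\<sigma>\<in>S. closed_strand \<sigma>)" if "c \<in> R" for c
      using bspec[OF R(1) that] by (simp add: case_prod_beta)
  qed (use agree proper disj R(2,3) in blast)+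
qed

text \<open>Crossings in \<open>R\<close> avoid the strands, while those in \<open>X\<close> and
  \<open>X'\<close> have their overpassage on one. So both sums split disjointly, and their parts
  over \<open>R\<close> agree term by term.\<close>

lemma cheng_poly_replace:
  assumes L: "virtual_link_diagram L" and L': "virtual_link_diagram L'"
    and "finite S" and move: "replaces_in_square S X X' L L'" and lab: "labels_agree_off S L C C'"
    and X: "fst ` (X \<union> X') \<subseteq> (\<Union>\<sigma>\<in>S. closed_strand \<sigma>)"
    and eq: "sum (crossing_term L' C') X' = sum (crossing_term L C) X"
  shows "cheng_poly L' C' = cheng_poly L C"
proof -
  obtain R where S: "\<And>\<sigma>. \<sigma> \<in> S \<Longrightarrow> proper_strand L \<sigma>" "curves_agree_off S L L'"
    and overs: "overs L = R \<union> X" "overs L' = R \<union> X'"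
    and R: "\<And>c. c \<in> R \<Longrightarrow>
      fst c \<notin> (\<Union>\<sigma>\<in>S. closed_strand \<sigma>) \<and> snd c \<notin> (\<Union>\<sigma>\<in>S. closed_strand \<sigma>)"
    by (rule replaces_in_squareE[OF move]) (rule that)
  have "c \<notin> R" if "c \<in> X \<union> X'" for c
    using R[of c] subsetD[OF X imageI[OF that]] by auto
  then have disj: "R \<inter> X = {}" "R \<inter> X' = {}"
    by auto
  have fin: "finite R" "finite X" "finite X'"
    using finite_overs[OF L] finite_overs[OF L'] overs by auto
  have "crossing_term L' C' c = crossing_term L C c" if "c \<in> R" for c
    using that R[OF that] overs
    by (intro crossing_term_agree_off[OF L L' assms(3) S(1) S(2) lab]) simp_all
  then show ?thesis
    using disj fin eq by (simp add: cheng_poly_eq_sum overs sum.union_disjoint)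
qed


section \<open>The first Reidemeister move\<close>

lemma fst_ordered_crossing: "fst (ordered_crossing o1 p q) = (if o1 then p else q)"
  and snd_ordered_crossing: "snd (ordered_crossing o1 p q) = (if o1 then q else p)"
  by (simp_all add: ordered_crossing_def)

lemma cheng_poly_reidemeister1:
  assumes L: "virtual_link_diagram L" and L': "virtual_link_diagram L'"
    and C': "cheng_coloring L' C'"
    and move: "reidemeister1 S L L'" and lab: "labels_agree_off S L C C'"
  shows "cheng_poly L' C' = cheng_poly L C"
proof -
  obtain i a b u v o1 where S: "S = {(i, a, b)}" "a < b"
    and rep: "replaces_in_square S {} {ordered_crossing o1 (i, u) (i, v)} L L'"
    and uv: "{(s, t). a \<le> s \<and> s < t \<and> t \<le> b \<and> curve L' i s = curve L' i t} = {(u, v)}"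
    using move unfolding reidemeister1_def by (elim exE conjE) (rule that)
  define c where "c = ordered_crossing o1 (i, u) (i, v)"
  have "(u, v) \<in> {(s, t). a \<le> s \<and> s < t \<and> t \<le> b \<and> curve L' i s = curve L' i t}"
    using uv by blast
  then have *: "a \<le> u" "u < v" "v \<le> b"
    by auto
  obtain R where n: "ncomp L' = ncomp L" and strands: "\<And>\<sigma>. \<sigma> \<in> S \<Longrightarrow> proper_strand L \<sigma>"
    and overs: "overs L' = R \<union> {c}"
    and R: "\<And>c. c \<in> R \<Longrightarrow>
      fst c \<notin> (\<Union>\<sigma>\<in>S. closed_strand \<sigma>) \<and> snd c \<notin> (\<Union>\<sigma>\<in>S. closed_strand \<sigma>)"
    by (rule replaces_in_squareE[OF rep[folded c_def]]) (rule that)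
  have proper: "proper_strand L (i, a, b)"
    using strands S by simp
  have i: "i < ncomp L'" and ab: "0 < a" "b < 1"
    using proper n by (auto simp: proper_strand_def)
  have c: "c \<in> overs L'"
    using overs by simp
  \<comment> \<open>A classical passage at \<open>w\<close> lies on the strand, hence belongs to
    \<open>c\<close>, whose only passages are at \<open>u\<close> and \<open>v\<close>.\<close>
  have not_classical: "\<not> classical_at L' i w" if w: "u < w" "w < v" for w
  proof
    assume "classical_at L' i w"
    moreover have "frac w = w"
      using w * ab by (simp add: frac_eq)
    ultimately obtain q where q: "((i, w), q) \<in> overs L' \<or> (q, (i, w)) \<in> overs L'"
      by (auto simp: classical_at_def)
    have "(i, w) \<in> (\<Union>\<sigma>\<in>S. closed_strand \<sigma>)"
      using w * S by (auto simp: closed_strand_def closed_segment_eq_real_ivl)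
    then have "((i, w), q) = c \<or> (q, (i, w)) = c"
      using q R[of "((i, w), q)"] R[of "(q, (i, w))"] overs by auto
    then show False
      using w by (auto simp: c_def ordered_crossing_def split: if_splits)
  qed
  \<comment> \<open>The outgoing label is the value at all parameters shortly after
    \<open>u\<close>; any of them before \<open>v\<close> lies on the arc that ends at
    \<open>v\<close>.\<close>
  have out: "incoming_label C' (i, v) = k" if "has_outgoing_label C' (i, u) k" for k
  proof -
    have "\<forall>\<^sub>F w in at_right u. C' i w = k"
      using that by (simp add: has_outgoing_label_def)
    moreover have "\<forall>\<^sub>F w in at_right u. w \<in> {u<..<v}"
      using *(2) by (rule eventually_at_right_real)
    ultimately have "\<forall>\<^sub>F w in at_right u. C' i w = k \<and> w \<in> {u<..<v}"
      by eventually_elim auto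
    then obtain w where w: "C' i w = k" "u < w" "w < v"
      using eventually_happens'[OF trivial_limit_at_right_real] by force
    have "arc_labelling L' C'"
      using C' by (simp add: cheng_coloring_def)
    then have "C' i w = C' i v"
      by (rule arc_labelling_eq) (use i w not_classical in auto)
    with w show ?thesis
      by (simp add: incoming_label_def)
  qed
  \<comment> \<open>From \<open>u\<close> to \<open>v\<close> the label changes by minus the sign if
    the first passage is over, and by the sign if it is under. In both cases this cancels the sign
    in \<open>weight_eq\<close>.\<close>
  have "weight L' C' c = 0"
    using outgoing_labels[OF C' c] out
    by (cases o1) (auto simp: weight_eq c_def fst_ordered_crossing snd_ordered_crossing)
  then have "crossing_term L' C' c = 0"
    by (simp add: crossing_term_def)
  moreover have "fst c \<in> closed_strand (i, a, b)"
    using * S by (auto simp: c_def fst_ordered_crossing closed_strand_def closed_segment_eq_real_ivl)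
  ultimately show ?thesis
    using S by (intro cheng_poly_replace[OF L L' _ rep lab]) (auto simp flip: c_def)
qed


section \<open>Labels along a strand\<close>

text \<open>The parameter in \<open>at_abscissa\<close>, as an affine map on the whole real line so
  that every parameter has an abscissa.\<close>

definition strand_param :: "strand \<Rightarrow> real \<Rightarrow> real" where
  "strand_param \<sigma> x = (1 - x) / 2 * fst (snd \<sigma>) + (1 + x) / 2 * snd (snd \<sigma>)"

text \<open>Eastward is 1, westward is -1; integers, because they enter signs and label changes as
  factors.\<close>

definition strand_dir :: "strand \<Rightarrow> int" where
  "strand_dir \<sigma> = (if fst (snd \<sigma>) < snd (snd \<sigma>) then 1 else - 1)"

definition strand_label :: "labelling \<Rightarrow> strand \<Rightarrow> real \<Rightarrow> int" where
  "strand_label C \<sigma> x = C (fst \<sigma>) (strand_param \<sigma> x)"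

lemma at_abscissa_eq_param: "at_abscissa \<sigma> x = (fst \<sigma>, strand_param \<sigma> x)"
  by (simp add: at_abscissa_def strand_param_def split: prod.split)

lemma incoming_label_at_abscissa: "incoming_label C (at_abscissa \<sigma> x) = strand_label C \<sigma> x"
  by (simp add: incoming_label_def strand_label_def at_abscissa_eq_param)

lemma strand_dir_cases: "strand_dir \<sigma> = 1 \<or> strand_dir \<sigma> = - 1"
  by (simp add: strand_dir_def)

lemma strand_param_diff:
  "strand_param \<sigma> y - strand_param \<sigma> x = (y - x) / 2 * (snd (snd \<sigma>) - fst (snd \<sigma>))"
  by (simp add: strand_param_def field_simps)

lemma proper_strandD:
  assumes "proper_strand L \<sigma>"
  shows "fst \<sigma> < ncomp L" "fst (snd \<sigma>) \<in> {0<..<1}" "snd (snd \<sigma>) \<in> {0<..<1}"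
    "fst (snd \<sigma>) \<noteq> snd (snd \<sigma>)"
  using assms by (simp_all add: proper_strand_def case_prod_beta)

lemma strand_param_less_iff:
  assumes "proper_strand L \<sigma>"
  shows "strand_param \<sigma> x < strand_param \<sigma> y \<longleftrightarrow> (if strand_dir \<sigma> = 1 then x < y else y < x)"
proof -
  define d where "d = snd (snd \<sigma>) - fst (snd \<sigma>)"
  have "d \<noteq> 0" and dir: "strand_dir \<sigma> = 1 \<longleftrightarrow> 0 < d"
    using proper_strandD(4)[OF assms] by (simp_all add: d_def strand_dir_def)
  have "strand_param \<sigma> x < strand_param \<sigma> y \<longleftrightarrow> 0 < (y - x) / 2 * d"
    unfolding d_def strand_param_diff[symmetric] by simp
  then show ?thesis
    using \<open>d \<noteq> 0\<close> by (simp add: dir zero_less_mult_iff not_less)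
qed

lemma strand_param_inj:
  assumes "proper_strand L \<sigma>" "strand_param \<sigma> x = strand_param \<sigma> y"
  shows "x = y"
  using strand_param_diff[of \<sigma> y x] proper_strandD(4)[OF assms(1)] assms(2) by simp

lemma strand_param_surj:
  assumes "proper_strand L \<sigma>"
  obtains w where "u = strand_param \<sigma> w"
proof (rule that)
  show "u = strand_param \<sigma> ((2 * u - fst (snd \<sigma>) - snd (snd \<sigma>)) / (snd (snd \<sigma>) - fst (snd \<sigma>)))"
    using proper_strandD(4)[OF assms] unfolding strand_param_def
    by (simp add: divide_simps) (simp add: algebra_simps)
qed

lemma at_abscissa_closed_strand:
  assumes "x \<in> {- 1..1}"
  shows "at_abscissa \<sigma> x \<in> closed_strand \<sigma>"
proof -
  have "strand_param \<sigma> x \<in> closed_segment (fst (snd \<sigma>)) (snd (snd \<sigma>))"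
    unfolding in_segment
    by (rule exI[of _ "(1 + x) / 2"]) (use assms in \<open>auto simp: strand_param_def field_simps\<close>)
  then show ?thesis
    by (simp add: at_abscissa_eq_param closed_strand_def case_prod_beta)
qed

lemma strand_param_unit:
  assumes "proper_strand L \<sigma>" "x \<in> {- 1..1}"
  shows "strand_param \<sigma> x \<in> {0<..<1}"
proof -
  have "strand_param \<sigma> x \<in> closed_segment (fst (snd \<sigma>)) (snd (snd \<sigma>))"
    using at_abscissa_closed_strand[OF assms(2), of \<sigma>]
    by (simp add: at_abscissa_eq_param closed_strand_def case_prod_beta)
  then show ?thesis
    using proper_strandD(2,3)[OF assms(1)]
    by (auto simp: closed_segment_eq_real_ivl split: if_splits)
qed

text \<open>
  The third clause is the convention that a passage through a classical crossing belongs to the arc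
  that ends there.
\<close>

definition label_on :: "labelling \<Rightarrow> strand \<Rightarrow> real \<Rightarrow> real \<Rightarrow> int \<Rightarrow> bool" where
  "label_on C \<sigma> x y m \<longleftrightarrow> x < y \<and> (\<forall>w\<in>{x<..<y}. strand_label C \<sigma> w = m) \<and>
     strand_label C \<sigma> (if strand_dir \<sigma> = 1 then y else x) = m"

text \<open>On a westward strand the parameter decreases with the abscissa, so the half-open
  interval of \<open>arc_labelling\<close> is reflected. In both cases it omits \<open>w'\<close>,
  where the arc may end.\<close>

lemma strand_label_eq:
  assumes arc: "arc_labelling L C" and \<sigma>: "proper_strand L \<sigma>"
    and "w \<noteq> w'" "strand_dir \<sigma> = 1 \<longleftrightarrow> w < w'"
    and free: "\<And>v. if strand_dir \<sigma> = 1 then w \<le> v \<and> v < w' else w' < v \<and> v \<le> w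
        \<Longrightarrow> \<not> classical_at L (fst \<sigma>) (strand_param \<sigma> v)"
  shows "strand_label C \<sigma> w = strand_label C \<sigma> w'"
  unfolding strand_label_def
proof (rule arc_labelling_eq[OF arc proper_strandD(1)[OF \<sigma>]])
  show "strand_param \<sigma> w < strand_param \<sigma> w'"
    using assms(3,4) by (simp add: strand_param_less_iff[OF \<sigma>])
  fix u
  assume u: "strand_param \<sigma> w \<le> u" "u < strand_param \<sigma> w'"
  obtain v where v: "u = strand_param \<sigma> v"
    using strand_param_surj[OF \<sigma>] .
  have "\<not> strand_param \<sigma> v < strand_param \<sigma> w" "strand_param \<sigma> v < strand_param \<sigma> w'"
    using u v by simp_all
  then show "\<not> classical_at L (fst \<sigma>) u"
    unfolding strand_param_less_iff[OF \<sigma>] v by (intro free) (auto split: if_splits)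
qed

text \<open>The end \<open>x\<close> is free as well, so its label belongs to the piece for either
  orientation. For \<open>x = - 1\<close> this ties the first piece to the edge of the square, where
  a move does not change labels.\<close>

lemma label_on_west:
  assumes arc: "arc_labelling L C" and \<sigma>: "proper_strand L \<sigma>" and "x < y"
    and free: "\<And>w. x \<le> w \<Longrightarrow> w < y \<Longrightarrow> \<not> classical_at L (fst \<sigma>) (strand_param \<sigma> w)"
  shows "label_on C \<sigma> x y (strand_label C \<sigma> x)"
proof (cases "strand_dir \<sigma> = 1")
  case True
  have "strand_label C \<sigma> w = strand_label C \<sigma> x" if "x < w" "w \<le> y" for w
    by (rule strand_label_eq[OF arc \<sigma>, symmetric]) (use True that free in auto)
  then show ?thesis
    using True \<open>x < y\<close> by (simp add: label_on_def)
next
  case False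
  have "strand_label C \<sigma> w = strand_label C \<sigma> x" if "x < w" "w < y" for w
    by (rule strand_label_eq[OF arc \<sigma>]) (use False that free in auto)
  then show ?thesis
    using False \<open>x < y\<close> by (simp add: label_on_def)
qed

text \<open>The label is read at the end that the orientation leads to, since a classical passage
  there still belongs to the piece.\<close>

lemma label_on_ex:
  assumes arc: "arc_labelling L C" and \<sigma>: "proper_strand L \<sigma>" and "x < y"
    and free: "\<And>w. x < w \<Longrightarrow> w < y \<Longrightarrow> \<not> classical_at L (fst \<sigma>) (strand_param \<sigma> w)"
  obtains m where "label_on C \<sigma> x y m"
proof (cases "strand_dir \<sigma> = 1")
  case True
  have "strand_label C \<sigma> w = strand_label C \<sigma> y" if "x < w" "w < y" for w
    by (rule strand_label_eq[OF arc \<sigma>]) (use True that free in auto)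
  then show ?thesis
    using True \<open>x < y\<close> by (intro that[of "strand_label C \<sigma> y"]) (simp add: label_on_def)
next
  case False
  have "strand_label C \<sigma> w = strand_label C \<sigma> x" if "x < w" "w < y" for w
    by (rule strand_label_eq[OF arc \<sigma>]) (use False that free in auto)
  then show ?thesis
    using False \<open>x < y\<close> by (intro that[of "strand_label C \<sigma> x"]) (simp add: label_on_def)
qed

text \<open>In the second and third moves every strand passes two classical crossings in the
  square.\<close>

lemma label_on_three_pieces:
  assumes arc: "arc_labelling L C" and \<sigma>: "proper_strand L \<sigma>"
    and "- 1 < x" "x < y" "y < 1"
    and free: "\<And>w. w \<in> {- 1..1} \<Longrightarrow> w \<noteq> x \<Longrightarrow> w \<noteq> y \<Longrightarrow>
      \<not> classical_at L (fst \<sigma>) (strand_param \<sigma> w)"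
  obtains m1 m2 where "label_on C \<sigma> (- 1) x (strand_label C \<sigma> (- 1))" "label_on C \<sigma> x y m1"
    "label_on C \<sigma> y 1 m2"
proof -
  have "label_on C \<sigma> (- 1) x (strand_label C \<sigma> (- 1))"
    by (rule label_on_west[OF arc \<sigma> \<open>- 1 < x\<close>]) (rule free, use assms(3-5) in auto)
  moreover obtain m1 where "label_on C \<sigma> x y m1"
    by (rule label_on_ex[OF arc \<sigma> \<open>x < y\<close>]) (rule free, use assms(3-5) in auto)
  moreover obtain m2 where "label_on C \<sigma> y 1 m2"
    by (rule label_on_ex[OF arc \<sigma> \<open>y < 1\<close>]) (rule free, use assms(3-5) in auto)
  ultimately show ?thesis
    by (rule that)
qed


text \<open>An eastward strand arrives with \<open>m\<close> and leaves with \<open>m'\<close>, a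
  westward one the other way round. The difference picks up the direction, the sum does not.\<close>

lemma label_across:
  assumes \<sigma>: "proper_strand L \<sigma>"
    and west: "label_on C \<sigma> x0 x m" and east: "label_on C \<sigma> x x1 m'"
    and out: "has_outgoing_label C (at_abscissa \<sigma> x) (strand_label C \<sigma> x - d)"
  shows "m - m' = strand_dir \<sigma> * d" "2 * strand_label C \<sigma> x - d = m + m'"
proof -
  have x: "x0 < x" "x < x1"
    using west east by (simp_all add: label_on_def)
  \<comment> \<open>The far end of the piece that the strand enters after the crossing.\<close>
  define z where "z = (if strand_dir \<sigma> = 1 then x1 else x0)"
  have "strand_param \<sigma> x < strand_param \<sigma> z"
    using x by (simp add: strand_param_less_iff[OF \<sigma>] z_def)
  then have "\<forall>\<^sub>F u in at_right (strand_param \<sigma> x). u \<in> {strand_param \<sigma> x<..<strand_param \<sigma> z}"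
    by (rule eventually_at_right_real)
  moreover have "\<forall>\<^sub>F u in at_right (strand_param \<sigma> x). C (fst \<sigma>) u = strand_label C \<sigma> x - d"
    using out by (simp add: has_outgoing_label_def at_abscissa_eq_param)
  ultimately have "\<forall>\<^sub>F u in at_right (strand_param \<sigma> x).
      u \<in> {strand_param \<sigma> x<..<strand_param \<sigma> z} \<and> C (fst \<sigma>) u = strand_label C \<sigma> x - d"
    by eventually_elim auto
  then obtain u where u: "strand_param \<sigma> x < u" "u < strand_param \<sigma> z"
    "C (fst \<sigma>) u = strand_label C \<sigma> x - d"
    using eventually_happens'[OF trivial_limit_at_right_real] by force
  obtain w where w: "u = strand_param \<sigma> w"
    using strand_param_surj[OF \<sigma>] .
  have lab: "strand_label C \<sigma> w = strand_label C \<sigma> x - d"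
    using u(3) by (simp add: strand_label_def w)
  have "m - m' = strand_dir \<sigma> * d \<and> 2 * strand_label C \<sigma> x - d = m + m'"
  proof (cases "strand_dir \<sigma> = 1")
    case True
    then have "x < w" "w < x1"
      using u(1,2) by (simp_all add: w strand_param_less_iff[OF \<sigma>] z_def)
    then show ?thesis
      using True west east lab by (auto simp: label_on_def)
  next
    case False
    then have "x0 < w" "w < x"
      using u(1,2) by (simp_all add: w strand_param_less_iff[OF \<sigma>] z_def)
    then show ?thesis
      using False strand_dir_cases[of \<sigma>] west east lab by (auto simp: label_on_def)
  qed
  then show "m - m' = strand_dir \<sigma> * d" "2 * strand_label C \<sigma> x - d = m + m'"
    by simp_all
qed


section \<open>Crossings of two graphs\<close>

text \<open>The chain rule for \<open>Complex w (f w)\<close>: its derivative is 1 plus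
  \<open>\<i>\<close> times the slope of \<open>f\<close>, and also the tangent times
  \<open>h\<close>, the derivative of \<open>strand_param\<close>.\<close>

lemma runs_along_derivative:
  assumes L: "virtual_link_diagram L" and \<sigma>: "proper_strand L \<sigma>" and f: "runs_along L \<sigma> f"
    and x: "x \<in> {- 1<..<1}"
  defines "h \<equiv> (snd (snd \<sigma>) - fst (snd \<sigma>)) / 2"
  shows "h * Re (tangent L (at_abscissa \<sigma> x)) = 1"
    and "(f has_real_derivative h * Im (tangent L (at_abscissa \<sigma> x))) (at x)"
proof -
  define v where "v = h *\<^sub>R tangent L (at_abscissa \<sigma> x)"
  have "(strand_param \<sigma> has_vector_derivative h) (at x)"
    unfolding has_real_derivative_iff_has_vector_derivative[symmetric] strand_param_def h_def
    by (auto intro!: derivative_eq_intros simp: field_simps)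
  moreover have "(curve L (fst \<sigma>) has_vector_derivative tangent L (at_abscissa \<sigma> x))
      (at (strand_param \<sigma> x))"
    using curve_has_vector_derivative[OF L proper_strandD(1)[OF \<sigma>], of "strand_param \<sigma> x"]
    by (simp add: tangent_def at_abscissa_eq_param)
  ultimately have "(curve L (fst \<sigma>) \<circ> strand_param \<sigma> has_vector_derivative v) (at x)"
    unfolding v_def by (rule vector_diff_chain_at)
  then have v: "((\<lambda>w. Complex w (f w)) has_vector_derivative v) (at x)"
  proof (rule has_vector_derivative_transform_within_open[where S = "{- 1<..<1}"])
    fix w :: real
    assume "w \<in> {- 1<..<1}"
    then show "(curve L (fst \<sigma>) \<circ> strand_param \<sigma>) w = Complex w (f w)"
      using f by (simp add: runs_along_def image_point_def at_abscissa_eq_param)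
  qed (use x in auto)
  have "((\<lambda>w. Re (Complex w (f w))) has_real_derivative Re v) (at x)"
    "((\<lambda>w. Im (Complex w (f w))) has_real_derivative Im v) (at x)"
    using v by (auto simp: has_vector_derivative_complex_iff)
  then have "((\<lambda>w. w) has_real_derivative Re v) (at x)" "(f has_real_derivative Im v) (at x)"
    by simp_all
  then show "h * Re (tangent L (at_abscissa \<sigma> x)) = 1"
    "(f has_real_derivative h * Im (tangent L (at_abscissa \<sigma> x))) (at x)"
    using DERIV_unique[OF _ DERIV_ident] by (auto simp: v_def)
qed

lemma runs_along_continuous:
  assumes L: "virtual_link_diagram L" and \<sigma>: "proper_strand L \<sigma>" and f: "runs_along L \<sigma> f"
  shows "continuous_on {- 1..1} f"
proof -
  have "continuous_on UNIV (curve L (fst \<sigma>))"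
    using curve_has_vector_derivative[OF L proper_strandD(1)[OF \<sigma>]]
    by (blast intro: continuous_at_imp_continuous_on has_vector_derivative_continuous)
  moreover have "continuous_on {- 1..1} (strand_param \<sigma>)"
    unfolding strand_param_def by (intro continuous_intros) simp_all
  ultimately have "continuous_on {- 1..1} (\<lambda>x. Im (curve L (fst \<sigma>) (strand_param \<sigma> x)))"
    by (intro continuous_on_Im continuous_on_compose2[of UNIV "curve L (fst \<sigma>)" _ "strand_param \<sigma>"])
       simp_all
  then show ?thesis
    by (rule continuous_on_eq)
       (use f in \<open>simp add: runs_along_def image_point_def at_abscissa_eq_param\<close>)
qed

lemma fst_graph_crossing: "fst (graph_crossing o1 \<sigma> \<tau> x) = at_abscissa (if o1 then \<sigma> else \<tau>) x"
  and snd_graph_crossing: "snd (graph_crossing o1 \<sigma> \<tau> x) = at_abscissa (if o1 then \<tau> else \<sigma>) x"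
  by (simp_all add: graph_crossing_def fst_ordered_crossing snd_ordered_crossing)

text \<open>Scaled by \<open>h\<close> and \<open>k\<close>, the tangents become (1, slope of
  \<open>f\<close>) and (1, slope of \<open>g\<close>), whose cross product \<open>D\<close> is the
  slope of \<open>g - f\<close>. As \<open>D\<close> is nonzero by transversality, the order of the
  graphs on one side of the zero gives its sign \<open>\<kappa>\<close>: -1 if
  \<open>\<sigma>\<close>, followed eastward, comes from below, and 1 if from above.\<close>

lemma graph_crossing_sign:
  assumes L: "virtual_link_diagram L" and \<sigma>: "proper_strand L \<sigma>" and \<tau>: "proper_strand L \<tau>"
    and f: "runs_along L \<sigma> f" and g: "runs_along L \<tau> g"
    and x: "x \<in> {- 1<..<1}" and c: "graph_crossing o1 \<sigma> \<tau> x \<in> overs L"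
    and \<kappa>: "\<kappa> = - 1 \<and> (\<forall>w\<in>{- 1..<x}. f w < g w) \<or> \<kappa> = 1 \<and> (\<forall>w\<in>{x<..1}. f w < g w)"
  shows "crossing_sign L (graph_crossing o1 \<sigma> \<tau> x) =
           (if o1 then 1 else - 1) * (strand_dir \<sigma> * strand_dir \<tau> * \<kappa>)"
proof -
  define h where "h = (snd (snd \<sigma>) - fst (snd \<sigma>)) / 2"
  define k where "k = (snd (snd \<tau>) - fst (snd \<tau>)) / 2"
  define u where "u = tangent L (at_abscissa \<sigma> x)"
  define v where "v = tangent L (at_abscissa \<tau> x)"
  define D where "D = k * Im v - h * Im u"
  note df = runs_along_derivative[OF L \<sigma> f x, folded h_def u_def]
  note dg = runs_along_derivative[OF L \<tau> g x, folded k_def v_def]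
  have hk: "sgn h = of_int (strand_dir \<sigma>)" "sgn k = of_int (strand_dir \<tau>)"
    using proper_strandD(4)[OF \<sigma>] proper_strandD(4)[OF \<tau>]
    by (auto simp: h_def k_def strand_dir_def sgn_if)
  have "h * k * cross2 u v = (h * Re u) * (k * Im v) - (h * Im u) * (k * Re v)"
    by (simp add: cross2_def algebra_simps)
  also have "\<dots> = D"
    by (simp add: df dg D_def)
  finally have D: "h * k * cross2 u v = D" .
  have "cross2 u v \<noteq> 0"
    using overs_transversal[OF L c] cross2_swap[of u v]
    by (cases o1) (simp_all add: fst_graph_crossing snd_graph_crossing u_def v_def)
  moreover have "h \<noteq> 0" "k \<noteq> 0"
    using df(1) dg(1) by auto
  ultimately have "D \<noteq> 0"
    using D by auto
  have "image_point L (at_abscissa \<sigma> x) = image_point L (at_abscissa \<tau> x)"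
    using overs_double_points[OF L c]
    by (cases o1) (auto simp: double_points_def graph_crossing_def ordered_crossing_def)
  then have fg: "f x = g x"
    using f g x by (simp add: runs_along_def)
  have dD: "((\<lambda>w. g w - f w) has_real_derivative D) (at x)"
    unfolding D_def using df(2) dg(2) by (intro derivative_intros)
  have sgnD: "sgn D = of_int \<kappa>"
    using \<kappa>
  proof (elim disjE conjE)
    assume "\<kappa> = - 1" and less: "\<forall>w\<in>{- 1..<x}. f w < g w"
    have "\<not> D > 0"
    proof
      assume "D > 0"
      from DERIV_pos_inc_left[OF dD this] obtain d
        where d: "d > 0" "\<And>e. 0 < e \<Longrightarrow> e < d \<Longrightarrow> g (x - e) - f (x - e) < g x - f x"
        by auto
      \<comment> \<open>The bound \<open>x + 1\<close> keeps \<open>x - e\<close> in the interval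
        where the order of the graphs is known.\<close>
      define e where "e = min (d / 2) (x + 1)"
      have "0 < e" "e < d" "e \<le> x + 1"
        using d(1) x by (auto simp: e_def)
      then show False
        using d(2)[of e] bspec[OF less, of "x - e"] fg by auto
    qed
    with \<open>D \<noteq> 0\<close> \<open>\<kappa> = - 1\<close> show ?thesis
      by (simp add: sgn_if)
  next
    assume "\<kappa> = 1" and less: "\<forall>w\<in>{x<..1}. f w < g w"
    have "\<not> D < 0"
    proof
      assume "D < 0"
      from DERIV_neg_dec_right[OF dD this] obtain d
        where d: "d > 0" "\<And>e. 0 < e \<Longrightarrow> e < d \<Longrightarrow> g (x + e) - f (x + e) < g x - f x"
        by auto
      define e where "e = min (d / 2) (1 - x)"
      have "0 < e" "e < d" "e \<le> 1 - x"
        using d(1) x by (auto simp: e_def)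
      then show False
        using d(2)[of e] bspec[OF less, of "x + e"] fg by auto
    qed
    with \<open>D \<noteq> 0\<close> \<open>\<kappa> = 1\<close> show ?thesis
      by (simp add: sgn_if)
  qed
  have "of_int (strand_dir \<sigma> * strand_dir \<tau>) * sgn (cross2 u v) = (of_int \<kappa> :: real)"
    using arg_cong[OF D, of sgn] by (simp add: sgn_mult hk sgnD)
  \<comment> \<open>Directions are their own inverses, so they may change sides.\<close>
  then have "sgn (cross2 u v) = of_int (strand_dir \<sigma> * strand_dir \<tau> * \<kappa>)"
    using strand_dir_cases[of \<sigma>] strand_dir_cases[of \<tau>] by auto
  then have "of_int (if cross2 u v > 0 then 1 else - 1) =
      (of_int (strand_dir \<sigma> * strand_dir \<tau> * \<kappa>) :: real)"
    using \<open>cross2 u v \<noteq> 0\<close> by (simp add: sgn_if split: if_splits)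
  then have s: "(if cross2 u v > 0 then 1 else - 1) = strand_dir \<sigma> * strand_dir \<tau> * \<kappa>"
    by (simp only: of_int_eq_iff)
  show ?thesis
  proof (cases o1)
    case True
    then show ?thesis
      using s by (simp add: crossing_sign_def fst_graph_crossing snd_graph_crossing u_def v_def)
  next
    case False
    have "crossing_sign L (graph_crossing o1 \<sigma> \<tau> x) = (if cross2 v u > 0 then 1 else - 1)"
      using False by (simp add: crossing_sign_def fst_graph_crossing snd_graph_crossing u_def v_def)
    also have "\<dots> = - (if cross2 u v > 0 then 1 else - 1)"
      using \<open>cross2 u v \<noteq> 0\<close> by (simp add: cross2_swap[of v u])
    finally show ?thesis
      using s False by simp
  qed
qed

text \<open>
  The weight of a crossing is half the difference of the incoming plus outgoing labels of its two
  strands.  In this form it does not depend on the orientations of the strands.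
\<close>

lemma graph_crossing_labels:
  assumes C: "cheng_coloring L C" and c: "graph_crossing o1 \<sigma> \<tau> x \<in> overs L"
    and \<sigma>: "proper_strand L \<sigma>" and \<tau>: "proper_strand L \<tau>"
    and m: "label_on C \<sigma> x0 x m" "label_on C \<sigma> x x1 m'"
    and n: "label_on C \<tau> y0 x n" "label_on C \<tau> x y1 n'"
    and sign: "crossing_sign L (graph_crossing o1 \<sigma> \<tau> x) =
           (if o1 then 1 else - 1) * (strand_dir \<sigma> * strand_dir \<tau> * \<kappa>)"
  shows "m - m' = strand_dir \<tau> * \<kappa>" "n - n' = - (strand_dir \<sigma> * \<kappa>)"
    "2 * weight L C (graph_crossing o1 \<sigma> \<tau> x) = (if o1 then 1 else - 1) * (m + m' - (n + n'))"
proof -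
  define k where "k = strand_dir \<sigma> * strand_dir \<tau> * \<kappa>"
  note out = outgoing_labels[OF C c, unfolded fst_graph_crossing snd_graph_crossing
      incoming_label_at_abscissa sign, folded k_def]
  \<comment> \<open>Exchanging over and under flips the sign and also which strand loses it;
    \<open>\<sigma>\<close> loses \<open>k\<close> in both cases.\<close>
  have "has_outgoing_label C (at_abscissa \<sigma> x) (strand_label C \<sigma> x - k)"
    "has_outgoing_label C (at_abscissa \<tau> x) (strand_label C \<tau> x - (- k))"
    using out by (cases o1; simp)+
  note lm = label_across[OF \<sigma> m this(1)] and ln = label_across[OF \<tau> n this(2)]
  show "m - m' = strand_dir \<tau> * \<kappa>" "n - n' = - (strand_dir \<sigma> * \<kappa>)"
    using lm(1) ln(1) strand_dir_cases[of \<sigma>] strand_dir_cases[of \<tau>] by (auto simp: k_def)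
  show "2 * weight L C (graph_crossing o1 \<sigma> \<tau> x) = (if o1 then 1 else - 1) * (m + m' - (n + n'))"
    using lm(2) ln(2) sign[folded k_def]
    by (cases o1)
       (simp_all add: weight_eq fst_graph_crossing snd_graph_crossing incoming_label_at_abscissa)
qed

text \<open>Otherwise \<open>g - f\<close> has a zero before \<open>x\<close> by the intermediate
  value theorem. This provides the one-sided order for \<open>graph_crossing_sign\<close>.\<close>

lemma less_before_first_zero:
  fixes f g :: "real \<Rightarrow> real"
  assumes "continuous_on {- 1..1} f" "continuous_on {- 1..1} g"
    and "f (- 1) < g (- 1)" "x \<le> 1" "\<And>w. w \<in> {- 1..<x} \<Longrightarrow> f w \<noteq> g w" "w \<in> {- 1..<x}"
  shows "f w < g w"
proof (rule ccontr)
  assume "\<not> f w < g w"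
  moreover have "continuous_on {- 1..w} (\<lambda>w. g w - f w)"
    by (rule continuous_on_subset[OF continuous_on_diff[OF assms(2,1)]]) (use assms(4,6) in auto)
  ultimately have "\<exists>z\<ge>- 1. z \<le> w \<and> g z - f z = 0"
    using assms(3,6) by (intro IVT2') auto
  then obtain z where "- 1 \<le> z" "z \<le> w" "g z = f z"
    by auto
  then show False
    using assms(5)[of z] assms(6) by auto
qed

text \<open>The same argument from the east edge, for a crossing at the last zero.\<close>

lemma less_after_last_zero:
  fixes f g :: "real \<Rightarrow> real"
  assumes "continuous_on {- 1..1} f" "continuous_on {- 1..1} g"
    and "f 1 < g 1" "- 1 \<le> x" "\<And>w. w \<in> {x<..1} \<Longrightarrow> f w \<noteq> g w" "w \<in> {x<..1}"
  shows "f w < g w"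
proof (rule ccontr)
  assume "\<not> f w < g w"
  moreover have "continuous_on {w..1} (\<lambda>w. g w - f w)"
    by (rule continuous_on_subset[OF continuous_on_diff[OF assms(2,1)]]) (use assms(4,6) in auto)
  ultimately have "\<exists>z\<ge>w. z \<le> 1 \<and> g z - f z = 0"
    using assms(3,6) by (intro IVT') auto
  then obtain z where "w \<le> z" "z \<le> 1" "g z = f z"
    by auto
  then show False
    using assms(5)[of z] assms(6) by auto
qed

section \<open>Points and classical passages on the strands in the square\<close>

lemma at_abscissa_eqD:
  assumes S: "\<And>\<sigma>. \<sigma> \<in> S \<Longrightarrow> proper_strand L \<sigma>"
    "\<And>\<sigma> \<tau>. \<sigma> \<in> S \<Longrightarrow> \<tau> \<in> S \<Longrightarrow> \<sigma> \<noteq> \<tau> \<Longrightarrow> closed_strand \<sigma> \<inter> closed_strand \<tau> = {}"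
    and "\<sigma> \<in> S" "\<tau> \<in> S" "x \<in> {- 1..1}" "y \<in> {- 1..1}" "at_abscissa \<sigma> x = at_abscissa \<tau> y"
  shows "\<sigma> = \<tau> \<and> x = y"
proof -
  have "at_abscissa \<sigma> x \<in> closed_strand \<sigma> \<inter> closed_strand \<tau>"
    using at_abscissa_closed_strand[of x \<sigma>] at_abscissa_closed_strand[of y \<tau>] assms(5-7) by simp
  then have "\<sigma> = \<tau>"
    using S(2)[OF assms(3,4)] by auto
  then show ?thesis
    using assms(7) strand_param_inj[OF S(1)[OF assms(3)]] by (simp add: at_abscissa_eq_param)
qed

text \<open>Strand parameters lie in (0, 1), where \<open>frac\<close> is the identity, so the
  passage itself occurs in a pair of \<open>overs K\<close>. This pair is not in \<open>R\<close>,
  which avoids the strands.\<close>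

lemma classical_at_strand:
  assumes S: "\<And>\<sigma>. \<sigma> \<in> S \<Longrightarrow> proper_strand L \<sigma>" and "\<sigma> \<in> S" "x \<in> {- 1..1}"
    and overs: "overs K = R \<union> X"
    and R: "\<And>c. c \<in> R \<Longrightarrow>
      fst c \<notin> (\<Union>\<sigma>\<in>S. closed_strand \<sigma>) \<and> snd c \<notin> (\<Union>\<sigma>\<in>S. closed_strand \<sigma>)"
    and "classical_at K (fst \<sigma>) (strand_param \<sigma> x)"
  obtains c where "c \<in> X" "at_abscissa \<sigma> x = fst c \<or> at_abscissa \<sigma> x = snd c"
proof -
  have "frac (strand_param \<sigma> x) = strand_param \<sigma> x"
    using strand_param_unit[OF S[OF \<open>\<sigma> \<in> S\<close>] \<open>x \<in> {- 1..1}\<close>] by (simp add: frac_eq)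
  then obtain q where "(at_abscissa \<sigma> x, q) \<in> overs K \<or> (q, at_abscissa \<sigma> x) \<in> overs K"
    using assms(6) by (auto simp: classical_at_def at_abscissa_eq_param)
  then obtain c where c: "c \<in> overs K" "at_abscissa \<sigma> x = fst c \<or> at_abscissa \<sigma> x = snd c"
    by (metis fst_conv snd_conv)
  have "at_abscissa \<sigma> x \<in> (\<Union>\<sigma>\<in>S. closed_strand \<sigma>)"
    using at_abscissa_closed_strand[OF \<open>x \<in> {- 1..1}\<close>] \<open>\<sigma> \<in> S\<close> by blast
  then have "c \<in> X"
    using R[of c] c overs by auto
  then show ?thesis
    using that c(2) by blast
qed


section \<open>The second Reidemeister move\<close>

lemma at_abscissa_eq_iff:
  assumes rep: "replaces_in_square S X X' L L'"
    and "\<sigma> \<in> S" "\<tau> \<in> S" "x \<in> {- 1..1}" "y \<in> {- 1..1}"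
  shows "at_abscissa \<sigma> x = at_abscissa \<tau> y \<longleftrightarrow> \<sigma> = \<tau> \<and> x = y"
proof -
  have "\<forall>\<sigma>\<in>S. proper_strand L \<sigma>"
    "\<forall>\<sigma>\<in>S. \<forall>\<tau>\<in>S. \<sigma> \<noteq> \<tau> \<longrightarrow> closed_strand \<sigma> \<inter> closed_strand \<tau> = {}"
    using rep unfolding replaces_in_square_def by - (elim conjE, assumption)+
  then show ?thesis
    using at_abscissa_eqD[of S L \<sigma> \<tau> x y] assms(2-) by blast
qed

lemma proper_strand_ncomp: "ncomp L' = ncomp L \<Longrightarrow> proper_strand L \<sigma> \<Longrightarrow> proper_strand L' \<sigma>"
  by (simp add: proper_strand_def case_prod_beta)

lemma cheng_poly_reidemeister2:
  assumes L: "virtual_link_diagram L" and L': "virtual_link_diagram L'"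
    and C': "cheng_coloring L' C'"
    and move: "reidemeister2 S L L'" and lab: "labels_agree_off S L C C'"
  shows "cheng_poly L' C' = cheng_poly L C"
proof -
  obtain \<sigma> \<tau> f g f' g' x y o1 where S: "S = {\<sigma>, \<tau>}" "\<sigma> \<noteq> \<tau>"
    and rep: "replaces_in_square S {} {graph_crossing o1 \<sigma> \<tau> x, graph_crossing o1 \<sigma> \<tau> y} L L'"
    and f: "runs_along L' \<sigma> f'" and g: "runs_along L' \<tau> g'"
    and ends: "f' (- 1) < g' (- 1)" "f' 1 < g' 1" and "x < y"
    and zeros: "{w\<in>{- 1..1}. f' w = g' w} = {x, y}"
    using move unfolding reidemeister2_def by (elim exE conjE) (rule that)
  define c where "c = graph_crossing o1 \<sigma> \<tau>"
  obtain R where n: "ncomp L' = ncomp L" and proper: "\<And>\<sigma>. \<sigma> \<in> S \<Longrightarrow> proper_strand L \<sigma>"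
    and overs: "overs L' = R \<union> {c x, c y}"
    and R: "\<And>c. c \<in> R \<Longrightarrow>
      fst c \<notin> (\<Union>\<sigma>\<in>S. closed_strand \<sigma>) \<and> snd c \<notin> (\<Union>\<sigma>\<in>S. closed_strand \<sigma>)"
    by (rule replaces_in_squareE[OF rep[folded c_def]]) (rule that)
  have \<sigma>: "proper_strand L' \<sigma>" and \<tau>: "proper_strand L' \<tau>"
    using proper S by (simp_all add: proper_strand_ncomp[OF n])
  have arc: "arc_labelling L' C'"
    using C' by (simp add: cheng_coloring_def)
  have "x \<in> {w\<in>{- 1..1}. f' w = g' w}" "y \<in> {w\<in>{- 1..1}. f' w = g' w}"
    unfolding zeros by simp_all
  moreover from this have "x \<noteq> - 1" "y \<noteq> 1"
    using ends by auto
  ultimately have xy: "- 1 < x" "x < 1" "- 1 < y" "y < 1"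
    using \<open>x < y\<close> by simp_all
  have zero: "w = x \<or> w = y" if "w \<in> {- 1..1}" "f' w = g' w" for w
  proof -
    have "w \<in> {w\<in>{- 1..1}. f' w = g' w}"
      using that by simp
    then show ?thesis
      unfolding zeros by simp
  qed
  have cont: "continuous_on {- 1..1} f'" "continuous_on {- 1..1} g'"
    using runs_along_continuous[OF L' \<sigma> f] runs_along_continuous[OF L' \<tau> g] .
  have free: "\<not> classical_at L' (fst \<upsilon>) (strand_param \<upsilon> w)"
    if \<upsilon>: "\<upsilon> \<in> S" and w: "w \<in> {- 1..1}" "w \<noteq> x" "w \<noteq> y" for \<upsilon> w
  proof
    assume classical: "classical_at L' (fst \<upsilon>) (strand_param \<upsilon> w)"
    obtain d where "d \<in> {c x, c y}" "at_abscissa \<upsilon> w = fst d \<or> at_abscissa \<upsilon> w = snd d"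
      using classical_at_strand[OF proper \<upsilon> w(1) overs R classical] by blast
    then have "\<exists>\<rho>\<in>S. \<exists>v\<in>{x, y}. at_abscissa \<upsilon> w = at_abscissa \<rho> v"
      using S by (auto simp: c_def fst_graph_crossing snd_graph_crossing split: if_splits)
    then show False
      using w xy \<upsilon> by (auto simp: at_abscissa_eq_iff[OF rep])
  qed
  obtain m1 m2 where m: "label_on C' \<sigma> (- 1) x (strand_label C' \<sigma> (- 1))"
    "label_on C' \<sigma> x y m1" "label_on C' \<sigma> y 1 m2"
    by (rule label_on_three_pieces[OF arc \<sigma> xy(1) \<open>x < y\<close> xy(4)]) (use free[of \<sigma>] S in auto)
  obtain n1 n2 where n: "label_on C' \<tau> (- 1) x (strand_label C' \<tau> (- 1))"
    "label_on C' \<tau> x y n1" "label_on C' \<tau> y 1 n2"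
    by (rule label_on_three_pieces[OF arc \<tau> xy(1) \<open>x < y\<close> xy(4)]) (use free[of \<tau>] S in auto)
  have cx: "c x \<in> overs L'" and cy: "c y \<in> overs L'"
    by (simp_all add: overs)
  \<comment> \<open>West of the first zero and east of the last one \<open>\<sigma>\<close> runs
    below \<open>\<tau>\<close>, so \<open>\<kappa>\<close> is -1 at \<open>x\<close> and 1 at
    \<open>y\<close>.\<close>
  have "\<forall>w\<in>{- 1..<x}. f' w < g' w"
    by (intro ballI less_before_first_zero[OF cont ends(1), of x]) (use zero xy \<open>x < y\<close> in force)+
  have sx: "crossing_sign L' (c x) = (if o1 then 1 else - 1) * (strand_dir \<sigma> * strand_dir \<tau> * (- 1))"
    unfolding c_def
  proof (rule graph_crossing_sign[OF L' \<sigma> \<tau> f g _ cx[unfolded c_def]])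
    show "- 1 = (- 1 :: int) \<and> (\<forall>w\<in>{- 1..<x}. f' w < g' w) \<or>
          - 1 = (1 :: int) \<and> (\<forall>w\<in>{x<..1}. f' w < g' w)"
      using \<open>\<forall>w\<in>{- 1..<x}. f' w < g' w\<close> by simp
  qed (use xy in simp)
  have "\<forall>w\<in>{y<..1}. f' w < g' w"
  proof (intro ballI less_after_last_zero[OF cont ends(2), of y])
    fix w
    assume "w \<in> {y<..1}"
    then show "f' w \<noteq> g' w"
      using zero[of w] xy \<open>x < y\<close> by auto
  qed (use xy in auto)
  have sy: "crossing_sign L' (c y) = (if o1 then 1 else - 1) * (strand_dir \<sigma> * strand_dir \<tau> * 1)"
    unfolding c_def
  proof (rule graph_crossing_sign[OF L' \<sigma> \<tau> f g _ cy[unfolded c_def]])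
    show "1 = (- 1 :: int) \<and> (\<forall>w\<in>{- 1..<y}. f' w < g' w) \<or>
          1 = (1 :: int) \<and> (\<forall>w\<in>{y<..1}. f' w < g' w)"
      using \<open>\<forall>w\<in>{y<..1}. f' w < g' w\<close> by simp
  qed (use xy in simp)
  note wx = graph_crossing_labels[OF C' cx[unfolded c_def] \<sigma> \<tau> m(1,2) n(1,2) sx[unfolded c_def]]
  note wy = graph_crossing_labels[OF C' cy[unfolded c_def] \<sigma> \<tau> m(2,3) n(2,3) sy[unfolded c_def]]
  \<comment> \<open>The second crossing undoes the label changes of the first, so both weights are
    computed from the same four labels.\<close>
  have "strand_label C' \<sigma> (- 1) = m2" "strand_label C' \<tau> (- 1) = n2"
    using wx(1,2) wy(1,2) by simp_all
  then have "2 * weight L' C' (c x) = 2 * weight L' C' (c y)"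
    using wx(3) wy(3) by (simp add: c_def)
  moreover have "crossing_sign L' (c y) = - crossing_sign L' (c x)"
    by (simp add: sx sy)
  ultimately have "crossing_term L' C' (c x) + crossing_term L' C' (c y) = 0"
    by (simp add: crossing_term_def)
  \<comment> \<open>Ensures that the sum over the set \<open>{c x, c y}\<close> contains both
    terms.\<close>
  moreover have "c x \<noteq> c y"
  proof
    assume "c x = c y"
    then have "fst (c x) = fst (c y)"
      by simp
    then show False
      using S xy \<open>x < y\<close> by (auto simp: c_def fst_graph_crossing at_abscissa_eq_iff[OF rep])
  qed
  moreover have "fst ` ({} \<union> {c x, c y}) \<subseteq> (\<Union>\<sigma>\<in>S. closed_strand \<sigma>)"
    using S xy at_abscissa_closed_strand[of x] at_abscissa_closed_strand[of y]
    by (auto simp: c_def fst_graph_crossing)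
  ultimately show ?thesis
    using S by (intro cheng_poly_replace[OF L L' _ rep[folded c_def] lab]) simp_all
qed


section \<open>The third Reidemeister move\<close>

text \<open>Graphs that exchange their order cross with \<open>\<kappa> = - 1\<close> wherever the
  crossing lies. So the sign depends only on the directions and on which strand is over, data that a
  third move preserves.\<close>

lemma transposed_strands:
  assumes L: "virtual_link_diagram L" and \<sigma>: "proper_strand L \<sigma>" and \<tau>: "proper_strand L \<tau>"
    and f: "runs_along L \<sigma> f" and g: "runs_along L \<tau> g"
    and ends: "f (- 1) < g (- 1)" "g 1 < f 1" and zeros: "{w\<in>{- 1..1}. f w = g w} = {x}"
  shows "x \<in> {- 1<..<1}"
    and "graph_crossing o1 \<sigma> \<tau> x \<in> overs L \<Longrightarrow> crossing_sign L (graph_crossing o1 \<sigma> \<tau> x) =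
           (if o1 then 1 else - 1) * (strand_dir \<sigma> * strand_dir \<tau> * (- 1))"
proof -
  have "x \<in> {w\<in>{- 1..1}. f w = g w}"
    unfolding zeros by simp
  moreover from this have "x \<noteq> - 1" "x \<noteq> 1"
    using ends by auto
  ultimately show x: "x \<in> {- 1<..<1}"
    by simp
  have ne: "f w \<noteq> g w" if "w \<in> {- 1..<x}" for w
  proof
    assume "f w = g w"
    then have "w \<in> {w\<in>{- 1..1}. f w = g w}"
      using that x by simp
    then show False
      using that unfolding zeros by simp
  qed
  assume c: "graph_crossing o1 \<sigma> \<tau> x \<in> overs L"
  show "crossing_sign L (graph_crossing o1 \<sigma> \<tau> x) =
           (if o1 then 1 else - 1) * (strand_dir \<sigma> * strand_dir \<tau> * (- 1))"
  proof (rule graph_crossing_sign[OF L \<sigma> \<tau> f g x c])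
    show "- 1 = (- 1 :: int) \<and> (\<forall>w\<in>{- 1..<x}. f w < g w) \<or>
          - 1 = (1 :: int) \<and> (\<forall>w\<in>{x<..1}. f w < g w)"
      using less_before_first_zero[OF runs_along_continuous[OF L \<sigma> f] runs_along_continuous[OF L \<tau> g]
          ends(1), of x] ne x by simp
  qed
qed

lemma triangle_transposed:
  assumes L: "virtual_link_diagram L" and tri: "triangle L \<sigma>1 \<sigma>2 \<sigma>3 x12 x13 x23"
    and proper: "proper_strand L \<sigma>1" "proper_strand L \<sigma>2" "proper_strand L \<sigma>3"
  shows "x12 \<in> {- 1<..<1}" "x13 \<in> {- 1<..<1}" "x23 \<in> {- 1<..<1}"
    and "graph_crossing o1 \<sigma>1 \<sigma>2 x12 \<in> overs L \<Longrightarrow> crossing_sign L (graph_crossing o1 \<sigma>1 \<sigma>2 x12) =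
           (if o1 then 1 else - 1) * (strand_dir \<sigma>1 * strand_dir \<sigma>2 * (- 1))"
    and "graph_crossing o2 \<sigma>1 \<sigma>3 x13 \<in> overs L \<Longrightarrow> crossing_sign L (graph_crossing o2 \<sigma>1 \<sigma>3 x13) =
           (if o2 then 1 else - 1) * (strand_dir \<sigma>1 * strand_dir \<sigma>3 * (- 1))"
    and "graph_crossing o3 \<sigma>2 \<sigma>3 x23 \<in> overs L \<Longrightarrow> crossing_sign L (graph_crossing o3 \<sigma>2 \<sigma>3 x23) =
           (if o3 then 1 else - 1) * (strand_dir \<sigma>2 * strand_dir \<sigma>3 * (- 1))"
proof -
  obtain f1 f2 f3 where f: "runs_along L \<sigma>1 f1" "runs_along L \<sigma>2 f2" "runs_along L \<sigma>3 f3"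
    and west: "f1 (- 1) < f2 (- 1)" "f2 (- 1) < f3 (- 1)" and east: "f3 1 < f2 1" "f2 1 < f1 1"
    and zeros: "{w\<in>{- 1..1}. f1 w = f2 w} = {x12}" "{w\<in>{- 1..1}. f1 w = f3 w} = {x13}"
      "{w\<in>{- 1..1}. f2 w = f3 w} = {x23}"
    using tri unfolding triangle_def by (elim exE conjE) (rule that)
  have "f1 (- 1) < f3 (- 1)" "f3 1 < f1 1"
    using west east by simp_all
  note t12 = transposed_strands[OF L proper(1,2) f(1,2) west(1) east(2) zeros(1)]
    and t13 = transposed_strands[OF L proper(1,3) f(1,3) this zeros(2)]
    and t23 = transposed_strands[OF L proper(2,3) f(2,3) west(2) east(1) zeros(3)]
  show "x12 \<in> {- 1<..<1}" "x13 \<in> {- 1<..<1}" "x23 \<in> {- 1<..<1}"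
    by (fact t12(1) t13(1) t23(1))+
  show "graph_crossing o1 \<sigma>1 \<sigma>2 x12 \<in> overs L \<Longrightarrow> crossing_sign L (graph_crossing o1 \<sigma>1 \<sigma>2 x12) =
           (if o1 then 1 else - 1) * (strand_dir \<sigma>1 * strand_dir \<sigma>2 * (- 1))"
    "graph_crossing o2 \<sigma>1 \<sigma>3 x13 \<in> overs L \<Longrightarrow> crossing_sign L (graph_crossing o2 \<sigma>1 \<sigma>3 x13) =
           (if o2 then 1 else - 1) * (strand_dir \<sigma>1 * strand_dir \<sigma>3 * (- 1))"
    "graph_crossing o3 \<sigma>2 \<sigma>3 x23 \<in> overs L \<Longrightarrow> crossing_sign L (graph_crossing o3 \<sigma>2 \<sigma>3 x23) =
           (if o3 then 1 else - 1) * (strand_dir \<sigma>2 * strand_dir \<sigma>3 * (- 1))"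
    by (erule t12(2) t13(2) t23(2))+
qed

text \<open>West labels and directions determine all labels, and both orders of the crossings give
  the same formulas. Before the crossing of strands 1 and 2, read eastward, both or neither have met
  strand 3, whose contributions cancel; likewise strand 1 at the crossing of 2 and 3. Before the
  crossing of 1 and 3 exactly one of them has met strand 2, which adds
  \<open>2 * strand_dir \<sigma>2\<close> in either order.\<close>

lemma triangle_weights:
  assumes L: "virtual_link_diagram L" and C: "cheng_coloring L C"
    and tri: "triangle L \<sigma>1 \<sigma>2 \<sigma>3 x12 x13 x23"
    and order: "x12 < x13 \<and> x13 < x23 \<or> x23 < x13 \<and> x13 < x12"
    and proper: "proper_strand L \<sigma>1" "proper_strand L \<sigma>2" "proper_strand L \<sigma>3"
    and overs: "graph_crossing o1 \<sigma>1 \<sigma>2 x12 \<in> overs L" "graph_crossing o2 \<sigma>1 \<sigma>3 x13 \<in> overs L"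
      "graph_crossing o3 \<sigma>2 \<sigma>3 x23 \<in> overs L"
    and free:
      "\<forall>w\<in>{- 1..1} - {x12, x13}. \<not> classical_at L (fst \<sigma>1) (strand_param \<sigma>1 w)"
      "\<forall>w\<in>{- 1..1} - {x12, x23}. \<not> classical_at L (fst \<sigma>2) (strand_param \<sigma>2 w)"
      "\<forall>w\<in>{- 1..1} - {x13, x23}. \<not> classical_at L (fst \<sigma>3) (strand_param \<sigma>3 w)"
  shows "2 * weight L C (graph_crossing o1 \<sigma>1 \<sigma>2 x12) = (if o1 then 1 else - 1) *
           (2 * strand_label C \<sigma>1 (- 1) - 2 * strand_label C \<sigma>2 (- 1) +
            strand_dir \<sigma>1 + strand_dir \<sigma>2) \<and>
         2 * weight L C (graph_crossing o2 \<sigma>1 \<sigma>3 x13) = (if o2 then 1 else - 1) *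
           (2 * strand_label C \<sigma>1 (- 1) - 2 * strand_label C \<sigma>3 (- 1) +
            strand_dir \<sigma>1 + 2 * strand_dir \<sigma>2 + strand_dir \<sigma>3) \<and>
         2 * weight L C (graph_crossing o3 \<sigma>2 \<sigma>3 x23) = (if o3 then 1 else - 1) *
           (2 * strand_label C \<sigma>2 (- 1) - 2 * strand_label C \<sigma>3 (- 1) +
            strand_dir \<sigma>2 + strand_dir \<sigma>3)"
proof -
  note x = triangle_transposed(1-3)[OF L tri proper]
  note sign = triangle_transposed(4)[OF L tri proper overs(1)]
    triangle_transposed(5)[OF L tri proper overs(2)] triangle_transposed(6)[OF L tri proper overs(3)]
  have arc: "arc_labelling L C"
    using C by (simp add: cheng_coloring_def)
  note pieces = label_on_three_pieces[OF arc]
  note labels12 = graph_crossing_labels[OF C overs(1) proper(1,2) _ _ _ _ sign(1)]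
    and labels13 = graph_crossing_labels[OF C overs(2) proper(1,3) _ _ _ _ sign(2)]
    and labels23 = graph_crossing_labels[OF C overs(3) proper(2,3) _ _ _ _ sign(3)]
  show ?thesis
    using order
  proof (elim disjE conjE)
    assume lt: "x12 < x13" "x13 < x23"
    obtain a1 a2 where a: "label_on C \<sigma>1 (- 1) x12 (strand_label C \<sigma>1 (- 1))"
      "label_on C \<sigma>1 x12 x13 a1" "label_on C \<sigma>1 x13 1 a2"
      by (rule pieces[OF proper(1), of x12 x13]) (use lt x free(1) in auto)
    obtain b1 b2 where b: "label_on C \<sigma>2 (- 1) x12 (strand_label C \<sigma>2 (- 1))"
      "label_on C \<sigma>2 x12 x23 b1" "label_on C \<sigma>2 x23 1 b2"
      by (rule pieces[OF proper(2), of x12 x23]) (use lt x free(2) in auto)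
    obtain c1 c2 where c: "label_on C \<sigma>3 (- 1) x13 (strand_label C \<sigma>3 (- 1))"
      "label_on C \<sigma>3 x13 x23 c1" "label_on C \<sigma>3 x23 1 c2"
      by (rule pieces[OF proper(3), of x13 x23]) (use lt x free(3) in auto)
    note l12 = labels12[OF a(1,2) b(1,2)] and l13 = labels13[OF a(2,3) c(1,2)]
      and l23 = labels23[OF b(2,3) c(2,3)]
    have "a1 = strand_label C \<sigma>1 (- 1) + strand_dir \<sigma>2" "a2 = a1 + strand_dir \<sigma>3"
      "b1 = strand_label C \<sigma>2 (- 1) - strand_dir \<sigma>1" "b2 = b1 + strand_dir \<sigma>3"
      "c1 = strand_label C \<sigma>3 (- 1) - strand_dir \<sigma>1" "c2 = c1 - strand_dir \<sigma>2"
      using l12(1,2) l13(1,2) l23(1,2) by simp_all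
    then show ?thesis
      using l12(3) l13(3) l23(3) by simp
  next
    assume lt: "x23 < x13" "x13 < x12"
    obtain a1 a2 where a: "label_on C \<sigma>1 (- 1) x13 (strand_label C \<sigma>1 (- 1))"
      "label_on C \<sigma>1 x13 x12 a1" "label_on C \<sigma>1 x12 1 a2"
      by (rule pieces[OF proper(1), of x13 x12]) (use lt x free(1) in auto)
    obtain b1 b2 where b: "label_on C \<sigma>2 (- 1) x23 (strand_label C \<sigma>2 (- 1))"
      "label_on C \<sigma>2 x23 x12 b1" "label_on C \<sigma>2 x12 1 b2"
      by (rule pieces[OF proper(2), of x23 x12]) (use lt x free(2) in auto)
    obtain c1 c2 where c: "label_on C \<sigma>3 (- 1) x23 (strand_label C \<sigma>3 (- 1))"
      "label_on C \<sigma>3 x23 x13 c1" "label_on C \<sigma>3 x13 1 c2"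
      by (rule pieces[OF proper(3), of x23 x13]) (use lt x free(3) in auto)
    note l12 = labels12[OF a(2,3) b(2,3)] and l13 = labels13[OF a(1,2) c(2,3)]
      and l23 = labels23[OF b(1,2) c(1,2)]
    have "a1 = strand_label C \<sigma>1 (- 1) + strand_dir \<sigma>3" "a2 = a1 + strand_dir \<sigma>2"
      "b1 = strand_label C \<sigma>2 (- 1) + strand_dir \<sigma>3" "b2 = b1 - strand_dir \<sigma>1"
      "c1 = strand_label C \<sigma>3 (- 1) - strand_dir \<sigma>2" "c2 = c1 - strand_dir \<sigma>1"
      using l12(1,2) l13(1,2) l23(1,2) by simp_all
    then show ?thesis
      using l12(3) l13(3) l23(3) by simp
  qed
qed

text \<open>Stated for any \<open>K\<close> to serve both diagrams of the move, whose crossings in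
  the square differ only in their abscissae.\<close>

lemma triangle_free:
  assumes rep: "replaces_in_square S X X' L L'" and S: "S = {\<sigma>1, \<sigma>2, \<sigma>3}" "distinct [\<sigma>1, \<sigma>2, \<sigma>3]"
    and overs: "overs K = R \<union> {graph_crossing o1 \<sigma>1 \<sigma>2 x12, graph_crossing o2 \<sigma>1 \<sigma>3 x13,
      graph_crossing o3 \<sigma>2 \<sigma>3 x23}"
    and R: "\<forall>c\<in>R.
      fst c \<notin> (\<Union>\<sigma>\<in>S. closed_strand \<sigma>) \<and> snd c \<notin> (\<Union>\<sigma>\<in>S. closed_strand \<sigma>)"
    and x: "x12 \<in> {- 1<..<1}" "x13 \<in> {- 1<..<1}" "x23 \<in> {- 1<..<1}"
  shows "\<forall>w\<in>{- 1..1} - {x12, x13}. \<not> classical_at K (fst \<sigma>1) (strand_param \<sigma>1 w)"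
    and "\<forall>w\<in>{- 1..1} - {x12, x23}. \<not> classical_at K (fst \<sigma>2) (strand_param \<sigma>2 w)"
    and "\<forall>w\<in>{- 1..1} - {x13, x23}. \<not> classical_at K (fst \<sigma>3) (strand_param \<sigma>3 w)"
proof -
  have proper: "proper_strand L \<sigma>" if "\<sigma> \<in> S" for \<sigma>
    by (rule replaces_in_squareE[OF rep]) (use that in blast)
  \<comment> \<open>These are the six passages through the three crossings.\<close>
  have *: "(\<upsilon>, w) \<in> {(\<sigma>1, x12), (\<sigma>2, x12), (\<sigma>1, x13), (\<sigma>3, x13), (\<sigma>2, x23), (\<sigma>3, x23)}"
    if \<upsilon>: "\<upsilon> \<in> S" and w: "w \<in> {- 1..1}" and classical: "classical_at K (fst \<upsilon>) (strand_param \<upsilon> w)"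
    for \<upsilon> w
  proof -
    obtain c where c: "c \<in> {graph_crossing o1 \<sigma>1 \<sigma>2 x12, graph_crossing o2 \<sigma>1 \<sigma>3 x13,
        graph_crossing o3 \<sigma>2 \<sigma>3 x23}" "at_abscissa \<upsilon> w = fst c \<or> at_abscissa \<upsilon> w = snd c"
      using classical_at_strand[OF proper \<upsilon> w overs R[rule_format] classical] by blast
    have "\<exists>(\<rho>, v)\<in>{(\<sigma>1, x12), (\<sigma>2, x12), (\<sigma>1, x13), (\<sigma>3, x13), (\<sigma>2, x23), (\<sigma>3, x23)}.
        at_abscissa \<upsilon> w = at_abscissa \<rho> v"
      using c by (auto simp: fst_graph_crossing snd_graph_crossing split: if_splits)
    then show ?thesis
      using x w \<upsilon> S by (auto simp: at_abscissa_eq_iff[OF rep])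
  qed
  show "\<forall>w\<in>{- 1..1} - {x12, x13}. \<not> classical_at K (fst \<sigma>1) (strand_param \<sigma>1 w)"
    using *[of \<sigma>1] S by fastforce
  show "\<forall>w\<in>{- 1..1} - {x12, x23}. \<not> classical_at K (fst \<sigma>2) (strand_param \<sigma>2 w)"
    using *[of \<sigma>2] S by fastforce
  show "\<forall>w\<in>{- 1..1} - {x13, x23}. \<not> classical_at K (fst \<sigma>3) (strand_param \<sigma>3 w)"
    using *[of \<sigma>3] S by fastforce
qed

text \<open>Disjointness of the strands makes a crossing determine its two strands, so the three
  crossings are distinct.\<close>

lemma triangle_sum:
  assumes rep: "replaces_in_square S X X' L L'" and S: "S = {\<sigma>1, \<sigma>2, \<sigma>3}" "distinct [\<sigma>1, \<sigma>2, \<sigma>3]"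
    and x: "x12 \<in> {- 1<..<1}" "x13 \<in> {- 1<..<1}" "x23 \<in> {- 1<..<1}"
  shows "sum F {graph_crossing o1 \<sigma>1 \<sigma>2 x12, graph_crossing o2 \<sigma>1 \<sigma>3 x13, graph_crossing o3 \<sigma>2 \<sigma>3 x23} =
    F (graph_crossing o1 \<sigma>1 \<sigma>2 x12) + F (graph_crossing o2 \<sigma>1 \<sigma>3 x13) +
    (F (graph_crossing o3 \<sigma>2 \<sigma>3 x23) :: int fls)"
proof -
  have "at_abscissa \<sigma>1 x12 \<noteq> at_abscissa \<sigma>2 x23" "at_abscissa \<sigma>1 x12 \<noteq> at_abscissa \<sigma>3 x23"
    "at_abscissa \<sigma>1 x13 \<noteq> at_abscissa \<sigma>2 x23" "at_abscissa \<sigma>1 x13 \<noteq> at_abscissa \<sigma>3 x23"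
    "at_abscissa \<sigma>2 x12 \<noteq> at_abscissa \<sigma>1 x13" "at_abscissa \<sigma>2 x12 \<noteq> at_abscissa \<sigma>3 x13"
    using S x by (auto simp: at_abscissa_eq_iff[OF rep])
  then have "graph_crossing o1 \<sigma>1 \<sigma>2 x12 \<noteq> graph_crossing o2 \<sigma>1 \<sigma>3 x13"
    "graph_crossing o1 \<sigma>1 \<sigma>2 x12 \<noteq> graph_crossing o3 \<sigma>2 \<sigma>3 x23"
    "graph_crossing o2 \<sigma>1 \<sigma>3 x13 \<noteq> graph_crossing o3 \<sigma>2 \<sigma>3 x23"
    by (auto simp: graph_crossing_def ordered_crossing_def)
  then show ?thesis
    by (simp add: add.assoc)
qed

lemma cheng_poly_reidemeister3:
  assumes L: "virtual_link_diagram L" and C: "cheng_coloring L C"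
    and L': "virtual_link_diagram L'" and C': "cheng_coloring L' C'"
    and move: "reidemeister3 S L L'" and lab: "labels_agree_off S L C C'"
  shows "cheng_poly L' C' = cheng_poly L C"
proof -
  obtain \<sigma>1 \<sigma>2 \<sigma>3 h1 h2 h3 x12 x13 x23 y12 y13 y23 where
    S: "S = {\<sigma>1, \<sigma>2, \<sigma>3}" "distinct [\<sigma>1, \<sigma>2, \<sigma>3]"
    and rep': "replaces_in_square S (triangle_crossings \<sigma>1 \<sigma>2 \<sigma>3 h1 h2 h3 x12 x13 x23)
                          (triangle_crossings \<sigma>1 \<sigma>2 \<sigma>3 h1 h2 h3 y12 y13 y23) L L'"
    and tri: "triangle L \<sigma>1 \<sigma>2 \<sigma>3 x12 x13 x23" and order: "x12 < x13" "x13 < x23"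
    and tri': "triangle L' \<sigma>1 \<sigma>2 \<sigma>3 y12 y13 y23" and order': "y23 < y13" "y13 < y12"
    using move unfolding reidemeister3_def by (elim exE conjE) (rule that)
  define o1 o2 o3 where "o1 = (h2 < h1)" and "o2 = (h3 < h1)" and "o3 = (h3 < h2)"
  define X where "X x12 x13 x23 =
    {graph_crossing o1 \<sigma>1 \<sigma>2 x12, graph_crossing o2 \<sigma>1 \<sigma>3 x13, graph_crossing o3 \<sigma>2 \<sigma>3 x23}"
    for x12 x13 x23
  have X: "triangle_crossings \<sigma>1 \<sigma>2 \<sigma>3 h1 h2 h3 x12 x13 x23 = X x12 x13 x23" for x12 x13 x23
    by (simp add: triangle_crossings_def X_def o1_def o2_def o3_def)
  note rep = rep'[unfolded X]
  obtain R where n: "ncomp L' = ncomp L" and proper: "\<And>\<sigma>. \<sigma> \<in> S \<Longrightarrow> proper_strand L \<sigma>"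
    and overs: "overs L = R \<union> X x12 x13 x23" "overs L' = R \<union> X y12 y13 y23"
    and R: "\<And>c. c \<in> R \<Longrightarrow>
      fst c \<notin> (\<Union>\<sigma>\<in>S. closed_strand \<sigma>) \<and> snd c \<notin> (\<Union>\<sigma>\<in>S. closed_strand \<sigma>)"
    by (rule replaces_in_squareE[OF rep]) (rule that)
  have R': "\<forall>c\<in>R.
      fst c \<notin> (\<Union>\<sigma>\<in>S. closed_strand \<sigma>) \<and> snd c \<notin> (\<Union>\<sigma>\<in>S. closed_strand \<sigma>)"
    using R by blast
  have \<sigma>: "proper_strand L \<sigma>1" "proper_strand L \<sigma>2" "proper_strand L \<sigma>3"
    using proper S by simp_all
  note \<sigma>' = \<sigma>[THEN proper_strand_ncomp[OF n]]
  have c: "graph_crossing o1 \<sigma>1 \<sigma>2 x12 \<in> overs L" "graph_crossing o2 \<sigma>1 \<sigma>3 x13 \<in> overs L"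
    "graph_crossing o3 \<sigma>2 \<sigma>3 x23 \<in> overs L"
    and c': "graph_crossing o1 \<sigma>1 \<sigma>2 y12 \<in> overs L'" "graph_crossing o2 \<sigma>1 \<sigma>3 y13 \<in> overs L'"
    "graph_crossing o3 \<sigma>2 \<sigma>3 y23 \<in> overs L'"
    by (simp_all add: overs X_def)
  note x = triangle_transposed(1-3)[OF L tri \<sigma>] and y = triangle_transposed(1-3)[OF L' tri' \<sigma>']
  note sign = triangle_transposed(4)[OF L tri \<sigma> c(1)] triangle_transposed(5)[OF L tri \<sigma> c(2)]
    triangle_transposed(6)[OF L tri \<sigma> c(3)]
  note sign' = triangle_transposed(4)[OF L' tri' \<sigma>' c'(1)] triangle_transposed(5)[OF L' tri' \<sigma>' c'(2)]
    triangle_transposed(6)[OF L' tri' \<sigma>' c'(3)]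
  have "x12 < x13 \<and> x13 < x23 \<or> x23 < x13 \<and> x13 < x12"
    "y12 < y13 \<and> y13 < y23 \<or> y23 < y13 \<and> y13 < y12"
    using order order' by simp_all
  note weight = triangle_weights[OF L C tri this(1) \<sigma> c
      triangle_free[OF rep S overs(1)[unfolded X_def] R' x]]
    and weight' = triangle_weights[OF L' C' tri' this(2) \<sigma>' c'
      triangle_free[OF rep S overs(2)[unfolded X_def] R' y]]
  \<comment> \<open>The point at abscissa -1 is an end of its own strand and lies on no other, so it
    is off all open strands, where the labels agree.\<close>
  have west: "strand_label C' \<sigma> (- 1) = strand_label C \<sigma> (- 1)" if "\<sigma> \<in> S" for \<sigma>
  proof -
    have pre: "at_abscissa \<sigma> (- 1) \<in> preimages L"
      using proper_strandD[OF proper[OF that]]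
      by (simp add: at_abscissa_eq_param strand_param_def preimages_def)
    have "at_abscissa \<sigma> (- 1) \<notin> open_strand \<tau>" if "\<tau> \<in> S" for \<tau>
    proof
      assume in_\<tau>: "at_abscissa \<sigma> (- 1) \<in> open_strand \<tau>"
      then have "at_abscissa \<sigma> (- 1) \<in> closed_strand \<tau>"
        using open_strand_subset_closed_strand by blast
      moreover have "at_abscissa \<sigma> (- 1) \<in> closed_strand \<sigma>"
        by (rule at_abscissa_closed_strand) simp
      moreover have "closed_strand \<sigma> \<inter> closed_strand \<tau> = {}" if "\<sigma> \<noteq> \<tau>"
        by (rule replaces_in_squareE[OF rep]) (use \<open>\<sigma> \<in> S\<close> \<open>\<tau> \<in> S\<close> that in blast)
      ultimately have "\<sigma> = \<tau>"
        by blast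
      then show False
        using in_\<tau>
        by (simp add: at_abscissa_eq_param strand_param_def open_strand_def case_prod_beta
            open_segment_def)
    qed
    then have "at_abscissa \<sigma> (- 1) \<in> preimages L - (\<Union>\<tau>\<in>S. open_strand \<tau>)"
      using pre by blast
    then show ?thesis
      using lab by (auto simp: labels_agree_off_def at_abscissa_eq_param strand_label_def)
  qed
  then have W: "strand_label C' \<sigma>1 (- 1) = strand_label C \<sigma>1 (- 1)"
    "strand_label C' \<sigma>2 (- 1) = strand_label C \<sigma>2 (- 1)"
    "strand_label C' \<sigma>3 (- 1) = strand_label C \<sigma>3 (- 1)"
    using S by simp_all
  \<comment> \<open>The formulas of \<open>triangle_weights\<close> involve only directions, over
    and under, and west labels, all shared by the two diagrams.\<close>
  have "2 * weight L' C' (graph_crossing o1 \<sigma>1 \<sigma>2 y12) = 2 * weight L C (graph_crossing o1 \<sigma>1 \<sigma>2 x12)"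
    "2 * weight L' C' (graph_crossing o2 \<sigma>1 \<sigma>3 y13) = 2 * weight L C (graph_crossing o2 \<sigma>1 \<sigma>3 x13)"
    "2 * weight L' C' (graph_crossing o3 \<sigma>2 \<sigma>3 y23) = 2 * weight L C (graph_crossing o3 \<sigma>2 \<sigma>3 x23)"
    by (simp_all only: weight weight' W)
  then have "sum (crossing_term L' C') (X y12 y13 y23) = sum (crossing_term L C) (X x12 x13 x23)"
    unfolding X_def triangle_sum[OF rep S x] triangle_sum[OF rep S y]
    by (simp add: crossing_term_def sign sign')
  moreover have "fst ` (X x12 x13 x23 \<union> X y12 y13 y23) \<subseteq> (\<Union>\<sigma>\<in>S. closed_strand \<sigma>)"
  proof
    fix p
    assume "p \<in> fst ` (X x12 x13 x23 \<union> X y12 y13 y23)"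
    then have "\<exists>\<sigma>\<in>S. \<exists>z\<in>{x12, x13, x23, y12, y13, y23}. p = at_abscissa \<sigma> z"
      using S by (auto simp: X_def fst_graph_crossing)
    then obtain \<sigma> z where "\<sigma> \<in> S" "z \<in> {x12, x13, x23, y12, y13, y23}" "p = at_abscissa \<sigma> z"
      by blast
    moreover from this have "z \<in> {- 1..1}"
      using x y by auto
    ultimately show "p \<in> (\<Union>\<sigma>\<in>S. closed_strand \<sigma>)"
      using at_abscissa_closed_strand by blast
  qed
  ultimately show ?thesis
    using S by (intro cheng_poly_replace[OF L L' _ rep lab]) simp_all
qed


section \<open>The invariance theorem\<close>

lemma local_move_ncomp:
  assumes "local_move S L L'"
  shows "ncomp L' = ncomp L"
proof -
  have "curves_agree_off S L L'"
    using assms unfolding local_move_def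
  proof (elim disjE)
    assume "reidemeister1 S L L'"
    then show ?thesis
      unfolding reidemeister1_def replaces_in_square_def by (elim exE conjE)
  next
    assume "reidemeister2 S L L'"
    then show ?thesis
      unfolding reidemeister2_def replaces_in_square_def by (elim exE conjE)
  next
    assume "reidemeister3 S L L'"
    then show ?thesis
      unfolding reidemeister3_def replaces_in_square_def by (elim exE conjE)
  next
    assume "detour S L L'"
    then show ?thesis
      unfolding detour_def by (elim exE conjE)
  qed
  then show ?thesis
    by (simp add: curves_agree_off_def)
qed

lemma cheng_poly_local_move:
  assumes "virtual_link_diagram L" "cheng_coloring L C"
    and "virtual_link_diagram L'" "cheng_coloring L' C'"
    and "local_move S L L'" "labels_agree_off S L C C'"
  shows "cheng_poly L' C' = cheng_poly L C"
  using assms(5) unfolding local_move_def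
proof (elim disjE)
  assume "reidemeister1 S L L'"
  then show ?thesis by (rule cheng_poly_reidemeister1[OF assms(1,3,4) _ assms(6)])
next
  assume "reidemeister2 S L L'"
  then show ?thesis by (rule cheng_poly_reidemeister2[OF assms(1,3,4) _ assms(6)])
next
  assume "reidemeister3 S L L'"
  then show ?thesis by (rule cheng_poly_reidemeister3[OF assms(1-4) _ assms(6)])
next
  assume "detour S L L'"
  then show ?thesis by (rule cheng_poly_detour[OF assms(1,3) _ assms(6)])
qed

theorem mainTheorem6:
  fixes L L' :: diagram and C C' :: labelling
  assumes "virtual_link_diagram L" and "cheng_coloring L C"
    and "virtual_link_diagram L'" and "cheng_coloring L' C'"
    and "obtained_by_move L C L' C'"
  shows "cheng_poly L' C' = cheng_poly L C"
  using assms(5) unfolding obtained_by_move_def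
proof (elim disjE exE conjE)
  fix S
  assume "local_move S L L'" "labels_agree_off S L C C'"
  then show ?thesis
    by (rule cheng_poly_local_move[OF assms(1-4)])
next
  fix S
  assume move: "local_move S L' L" and lab: "labels_agree_off S L C C'"
  \<comment> \<open>For the inverse move the roles are exchanged; \<open>labels_agree_off\<close>
    quantifies over the preimage points of its diagram, so these must be the same for both.\<close>
  have "preimages L' = preimages L"
    by (simp add: preimages_def local_move_ncomp[OF move])
  then have "labels_agree_off S L' C' C"
    using lab by (simp add: labels_agree_off_def case_prod_beta eq_commute)
  from cheng_poly_local_move[OF assms(3,4,1,2) move this] show ?thesis
    by simp
next
  assume "planar_isotopic L L'" "labels_agree_off {} L C C'"
  then show ?thesis
    by (rule cheng_poly_planar_isotopic[OF assms(1)])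
next
  fix \<pi> \<rho>
  assume "reparametrised \<pi> \<rho> L L'" "\<forall>i<ncomp L. \<forall>s. C' i s = C (\<pi> i) (\<rho> i s)"
  then show ?thesis
    by (intro cheng_poly_reparametrised[OF assms(1,2,3)]) auto
qed

end
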